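(* Consider a network with routes of length one, $(I,J,(J(i))_{i\in I},(C_j)_{j\in J})$, with a fixed vector of numbers of flows $n=(n_i)_{i\in I}$. The optimal rate allocation $x=x(n)$ is obtained by the following algorithm. For $k=1,2,\dots$: (1) Compute the minimum $$x_k=\min_{J'\in\mathscr{SC}(J)} r(I(J'),J').$$ (2) Let $J_k$ be the union of all $J'\in\mathscr{SC}(J)$ attaining this minimum, and let $I_k:=I(J_k)$. (3) For all $i\in I_k$ (with $n_i>0$) set $x_i:=x_k$. (4) Replace the network by the reduced network: $I:=I\setminus I_k$, $J:=J\setminus J_k$, and $J(i):=J(i)\setminus J_k$ for the remaining users (so that the new $I(J')$ equals the old $I(J'\cup J_k)\setminus I(J_k)$). Repeat with the reduced network until no resources and no users are left. Moreover, the pair $(I_k,J_k)$ found at the $k$-th step is the union of all clusters at the $k$-th cluster level, and the strongly connected sets $J'$ that attain the minimum in (1), together with their corresponding $I(J')$, are the clusters of the network.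
   Context: Network: $I$ is a finite set of users (flow types), $J$ a finite set of resources, resource $j\in J$ has capacity $C_j>0$, and user $i$ can use exactly the resources in the nonempty set $J(i)\subseteq J$ (each route is a single resource). $n_i\ge 0$ is the number of flows of type $i$. Optimal allocation: let $U$ be a strictly concave, strictly increasing, differentiable utility function common to all users. The allocation $x(n)=(x_i)_{i\in I}$ is the solution of: maximize $\sum_{i\in I} n_iU(x_i)$ subject to $\sum_{i: j\in J(i)} n_ix_i^j\le C_j$ for all $j\in J$; $\sum_{j\in J(i)}x_i^j=x_i$ for all $i\in I$; $x_i^j\ge 0$ for all $i\in I$, $j\in J(i)$. Convention: $x_i=0$ if $n_i=0$. The allocation does not depend on the choice of $U$. Notation: for $J'\subseteq J$, $C(J')=\sum_{j\in J'}C_j$ and $I(J')=\{i\in I: J(i)\subseteq J'\}$. For $I'\subseteq I$, $J'\subseteq J$, $r(I',J')=C(J')/\sum_{i\in I'}n_i$ (equal to $+\infty$ if the denominator is $0$ and $J'\ne\emptyset$). Connectivity: a pair $(I',J')$ with $I'\subseteq I$, $J'\subseteq J$ is connected if $J'$ cannot be partitioned into nonempty $J_1,J_2$ such that $I'$ can be partitioned into (possibly empty) $I_1,I_2$ with $J(i)\cap J_2=\emptyset$ for $i\in I_1$ and $J(i)\cap J_1=\emptyset$ for $i\in I_2$. A nonempty $J'\subseteq J$ is strongly connected if $(I(J'),J')$ is connected; $\mathscr{SC}(J)$ is the set of strongly connected subsets of $J$. At each step of the algorithm all these notions refer to the current (reduced) network. Clusters: a cluster is a nonempty pair $(I',J')$,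 $I'\subseteq I$, $J'\subseteq J$, such that for $i\in I'$: $I'$ consists of all $i'\in I$ for which there is a path $i=i_0,i_1,\dots,i_m=i'$ in $I'$ and $j_1,\dots,j_m\in J'$ such that, for a feasible allocation solving the optimization problem, $x_{i_{k-1}}^{j_k}>0$ and $x_{i_k}^{j_k}>0$ for all $k=1,\dots,m$; and $J'$ consists of all $j\in J$ for which there is a path $i=i_0,\dots,i_{m-1}$ in $I'$, $j_1,\dots,j_m=j$ in $J'$ with, for a feasible allocation solving the problem, the corresponding $x_{i_{k-1}}^{j_k}$ ($1\le k\le m$) and $x_{i_k}^{j_k}$ ($1\le k\le m-1$) strictly positive. The clusters partition $(I,J)$; all users in a cluster have the same rate. Clusters with the same common rate are said to be at the same cluster level; levels are numbered in increasing order of the rate.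
   Formalization: Minimizing sets J' are shown to be the clusters only at steps where they are pairwise disjoint (else false); in general clusters are the parts of minimizers not covered by smaller ones. Users with n_i=0 are left out of clusters; an unused resource is its own cluster, of rate +∞. *)

theory Defs
  imports "HOL-Analysis.Analysis"
begin

record ('i, 'j) network =
  users :: "'i set"
  resources :: "'j set"
  route :: "'i \<Rightarrow> 'j set"
  capacity :: "'j \<Rightarrow> real"

definition wf_network :: "('i, 'j) network \<Rightarrow> bool" where
  "wf_network N \<longleftrightarrow>
     finite (users N) \<and> finite (resources N) \<and>
     (\<forall>i\<in>users N. route N i \<noteq> {} \<and> route N i \<subseteq> resources N) \<and>
     (\<forall>j\<in>resources N. 0 < capacity N j)"

text \<open>
  The hypotheses on \<open>U\<close> are only imposed on the positive half-line, and the value at \<open>0\<close> is the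
  limit from the right (the infimum, as \<open>U\<close> is increasing). This includes utilities such as the
  logarithm, for which that value is \<open>-\<infinity>\<close>.
\<close>

definition utility :: "(real \<Rightarrow> real) \<Rightarrow> bool" where
  "utility U \<longleftrightarrow>
     (\<forall>x>0. \<forall>y>0. \<forall>t. x \<noteq> y \<and> 0 < t \<and> t < 1 \<longrightarrow>
        (1 - t) * U x + t * U y < U ((1 - t) * x + t * y)) \<and>
     strict_mono_on {0<..} U \<and>
     U differentiable_on {0<..}"

definition utility_at :: "(real \<Rightarrow> real) \<Rightarrow> real \<Rightarrow> ereal" where
  "utility_at U x = (if 0 < x then ereal (U x) else (INF z\<in>{0<..}. ereal (U z)))"

text \<open>
  An allocation is given by its components \<open>y i j\<close> (the rate that each flow of user \<open>i\<close> gets from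
  resource \<open>j\<close>); only the values for \<open>j \<in> route N i\<close> matter. The last clause of \<open>feasible\<close> is the
  convention that users without flows have rate \<open>0\<close>.
\<close>

definition rate :: "('i, 'j) network \<Rightarrow> ('i \<Rightarrow> 'j \<Rightarrow> real) \<Rightarrow> 'i \<Rightarrow> real" where
  "rate N y i = (\<Sum>j\<in>route N i. y i j)"

definition feasible :: "('i, 'j) network \<Rightarrow> ('i \<Rightarrow> real) \<Rightarrow> ('i \<Rightarrow> 'j \<Rightarrow> real) \<Rightarrow> bool" where
  "feasible N n y \<longleftrightarrow>
     (\<forall>j\<in>resources N. (\<Sum>i | i \<in> users N \<and> j \<in> route N i. n i * y i j) \<le> capacity N j) \<and>
     (\<forall>i\<in>users N. \<forall>j\<in>route N i. 0 \<le> y i j) \<and>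
     (\<forall>i\<in>users N. n i = 0 \<longrightarrow> rate N y i = 0)"

text \<open>Recall that \<open>0 * (-\<infinity>) = 0\<close> in \<^typ>\<open>ereal\<close>: users without flows do not contribute.\<close>

definition objective ::
  "('i, 'j) network \<Rightarrow> ('i \<Rightarrow> real) \<Rightarrow> (real \<Rightarrow> real) \<Rightarrow> ('i \<Rightarrow> 'j \<Rightarrow> real) \<Rightarrow> ereal" where
  "objective N n U y = (\<Sum>i\<in>users N. ereal (n i) * utility_at U (rate N y i))"

definition optimal ::
  "('i, 'j) network \<Rightarrow> ('i \<Rightarrow> real) \<Rightarrow> (real \<Rightarrow> real) \<Rightarrow> ('i \<Rightarrow> 'j \<Rightarrow> real) \<Rightarrow> bool" where
  "optimal N n U y \<longleftrightarrow>
     feasible N n y \<and> (\<forall>z. feasible N n z \<longrightarrow> objective N n U z \<le> objective N n U y)"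

definition users_within :: "('i, 'j) network \<Rightarrow> 'j set \<Rightarrow> 'i set" where
  "users_within N J' = {i \<in> users N. route N i \<subseteq> J'}"

text \<open>The ratio is only used for nonempty \<open>J'\<close>.\<close>

definition ratio ::
  "('i, 'j) network \<Rightarrow> ('i \<Rightarrow> real) \<Rightarrow> 'i set \<Rightarrow> 'j set \<Rightarrow> ereal" where
  "ratio N n I' J' =
     (if sum n I' = 0 then \<infinity> else ereal (sum (capacity N) J' / sum n I'))"

definition connected_pair :: "('i, 'j) network \<Rightarrow> 'i set \<Rightarrow> 'j set \<Rightarrow> bool" where
  "connected_pair N I' J' \<longleftrightarrow>
     \<not> (\<exists>J1 J2 I1 I2.
          J1 \<noteq> {} \<and> J2 \<noteq> {} \<and> J1 \<union> J2 = J' \<and> J1 \<inter> J2 = {} \<and>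
          I1 \<union> I2 = I' \<and> I1 \<inter> I2 = {} \<and>
          (\<forall>i\<in>I1. route N i \<inter> J2 = {}) \<and> (\<forall>i\<in>I2. route N i \<inter> J1 = {}))"

definition strongly_connected :: "('i, 'j) network \<Rightarrow> 'j set set" where
  "strongly_connected N =
     {J'. J' \<noteq> {} \<and> J' \<subseteq> resources N \<and> connected_pair N (users_within N J') J'}"

definition min_ratio :: "('i, 'j) network \<Rightarrow> ('i \<Rightarrow> real) \<Rightarrow> ereal" where
  "min_ratio N n = (MIN J'\<in>strongly_connected N. ratio N n (users_within N J') J')"

definition minimizers :: "('i, 'j) network \<Rightarrow> ('i \<Rightarrow> real) \<Rightarrow> 'j set set" where
  "minimizers N n =
     {J' \<in> strongly_connected N. ratio N n (users_within N J') J' = min_ratio N n}"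

definition step_resources :: "('i, 'j) network \<Rightarrow> ('i \<Rightarrow> real) \<Rightarrow> 'j set" where
  "step_resources N n = \<Union> (minimizers N n)"

definition step_users :: "('i, 'j) network \<Rightarrow> ('i \<Rightarrow> real) \<Rightarrow> 'i set" where
  "step_users N n = users_within N (step_resources N n)"

definition reduced :: "('i, 'j) network \<Rightarrow> ('i \<Rightarrow> real) \<Rightarrow> ('i, 'j) network" where
  "reduced N n =
     N\<lparr>users := users N - step_users N n,
       resources := resources N - step_resources N n,
       route := (\<lambda>i. route N i - step_resources N n)\<rparr>"

text \<open>
  Steps and cluster levels are counted from \<open>0\<close>: \<open>residual N n k\<close> is the network after \<open>k\<close> steps,
  on which the next step operates.
\<close>

primrec residual :: "('i, 'j) network \<Rightarrow> ('i \<Rightarrow> real) \<Rightarrow> nat \<Rightarrow> ('i, 'j) network" where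
  "residual N n 0 = N"
| "residual N n (Suc k) = reduced (residual N n k) n"

definition link :: "('i, 'j) network \<Rightarrow> ('i \<Rightarrow> 'j \<Rightarrow> real) \<Rightarrow> ('i \<times> 'i) set" where
  "link N y =
     {(i, i'). i \<in> users N \<and> i' \<in> users N \<and>
        (\<exists>j \<in> route N i \<inter> route N i'. 0 < y i j \<and> 0 < y i' j)}"

text \<open>
  Paths range over all users and resources; they then automatically stay in the cluster.
  Since \<open>J'\<close> is required to be nonempty, users without flows belong to no cluster. A resource that
  carries no traffic cannot be reached from any user; it forms a cluster \<open>({}, {j})\<close> of its own, to
  which the infinite rate is assigned below.
\<close>

definition is_cluster ::
  "('i, 'j) network \<Rightarrow> ('i \<Rightarrow> real) \<Rightarrow> (real \<Rightarrow> real) \<Rightarrow> 'i set \<Rightarrow> 'j set \<Rightarrow> bool" where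
  "is_cluster N n U I' J' \<longleftrightarrow>
     I' \<subseteq> users N \<and> J' \<subseteq> resources N \<and> J' \<noteq> {} \<and>
     (\<forall>i\<in>I'.
        I' = {i' \<in> users N. \<exists>y. optimal N n U y \<and> (i, i') \<in> (link N y)\<^sup>*} \<and>
        J' = {j \<in> resources N. \<exists>y i'. optimal N n U y \<and> (i, i') \<in> (link N y)\<^sup>* \<and>
                                 j \<in> route N i' \<and> 0 < y i' j}) \<and>
     (I' = {} \<longrightarrow>
        (\<exists>j. J' = {j} \<and>
             (\<forall>y. optimal N n U y \<longrightarrow> (\<forall>i\<in>users N. j \<in> route N i \<longrightarrow> y i j = 0))))"

definition cluster_with_rate ::
  "('i, 'j) network \<Rightarrow> ('i \<Rightarrow> real) \<Rightarrow> (real \<Rightarrow> real) \<Rightarrow> ereal \<Rightarrow> 'i set \<Rightarrow> 'j set \<Rightarrow> bool" where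
  "cluster_with_rate N n U \<rho> I' J' \<longleftrightarrow>
     is_cluster N n U I' J' \<and>
     (\<forall>y. optimal N n U y \<longrightarrow> (\<forall>i\<in>I'. ereal (rate N y i) = \<rho>)) \<and>
     (I' = {} \<longrightarrow> \<rho> = \<infinity>)"

definition cluster_rates ::
  "('i, 'j) network \<Rightarrow> ('i \<Rightarrow> real) \<Rightarrow> (real \<Rightarrow> real) \<Rightarrow> ereal set" where
  "cluster_rates N n U = {\<rho>. \<exists>I' J'. cluster_with_rate N n U \<rho> I' J'}"

definition cluster_level ::
  "('i, 'j) network \<Rightarrow> ('i \<Rightarrow> real) \<Rightarrow> (real \<Rightarrow> real) \<Rightarrow> nat \<Rightarrow> ('i set \<times> 'j set) set" where
  "cluster_level N n U k =
     {(I', J'). cluster_with_rate N n U (sorted_list_of_set (cluster_rates N n U) ! k) I' J'}"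

definition active :: "('i \<Rightarrow> real) \<Rightarrow> 'i set \<Rightarrow> 'i set" where
  "active n I' = {i \<in> I'. 0 < n i}"

text \<open>
  If two minimizers overlap, they cannot both be clusters. For example, let all capacities and all
  numbers of flows be \<open>1\<close>, and let user \<open>a\<close> have route \<open>{1}\<close> and user \<open>b\<close> route \<open>{1, 2}\<close>: the
  minimizers are \<open>{1}\<close> and \<open>{1, 2}\<close>, but the clusters are \<open>({a}, {1})\<close> and \<open>({b}, {2})\<close>. In general,
  what has to be taken is the part of a minimizer that is not covered by smaller minimizers (for
  pairwise disjoint minimizers, this is the minimizer itself).
\<close>

definition smaller_minimizers ::
  "('i, 'j) network \<Rightarrow> ('i \<Rightarrow> real) \<Rightarrow> 'j set \<Rightarrow> 'j set set" where
  "smaller_minimizers N n J' = {S \<in> minimizers N n. S \<subset> J'}"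

definition own_resources :: "('i, 'j) network \<Rightarrow> ('i \<Rightarrow> real) \<Rightarrow> 'j set \<Rightarrow> 'j set" where
  "own_resources N n J' = J' - \<Union> (smaller_minimizers N n J')"

definition own_users :: "('i, 'j) network \<Rightarrow> ('i \<Rightarrow> real) \<Rightarrow> 'j set \<Rightarrow> 'i set" where
  "own_users N n J' =
     users_within N J' - (\<Union>S\<in>smaller_minimizers N n J'. users_within N S)"

end

(* An allocation is called fair if every resource that an active user may use is saturated and
   serves only users whose rate is at most the rate of every active user who may use it. Fair
   allocations are exactly the optimal ones: marginal utilities at the rates act as prices, and
   strict concavity makes the rates unique, hence independent of U. A minimizer of a quadratic cost
   is fair, so existence is a compactness argument.

   Among the optimal allocations fix y whose set of positive components is maximal. Draw an arrow
   from j to j' if some user gets a positive rate from j and may also use j'. Pushing flow around a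
   directed cycle preserves all rates and loads, so by maximality every arrow on a cycle carries
   positive flow at both ends. Hence the clusters with users are the strongly connected
   components of the resources in use.

   If \<rho> is the lowest rate, then C(J') \<ge> \<rho> n(I(J')), with equality only if J' is closed under
   arrows and used at rate \<rho> only. The set of resources that can be reached from a resource used at
   rate \<rho> is strongly connected and attains equality. It is thus the least minimizer containing
   that resource, and the part not covered by smaller minimizers is a strongly connected component.
   The reduced network with the same y has again all these properties. *)

theory Submission
  imports Defs
begin

section \<open>Fair allocations and the lowest level\<close>

text \<open>A utility may be \<open>-\<infinity>\<close> at \<open>0\<close>, so existence is not
  proved by maximizing \<open>U\<close>. The quadratic \<open>cost\<close> is finite and continuous,
  and along a line it is an exact quadratic polynomial, which makes first-order conditions
  elementary. A cluster is defined by paths, each of which may use its own optimal allocation.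
  Averaging two optimal allocations unites their supports; this is why a single \<open>y\<close> can
  stand for all of them. The obstacle is that \<open>link\<close> is symmetric and about positive
  rates, while tight sets are closed under the directed relation \<open>shift\<close>: a minimizer
  contains everything downstream of its clusters, so minimizers overlap. Recurrence turns directed
  cycles into links and so reconciles the two relations. The locales impose conditions on
  \<open>y\<close> itself instead of optimality. These pass to the reduced network, so no new
  optimization problem has to be solved after a step. Once no flows are left there is no lowest
  rate; all ratios are infinite, and the remaining resources form a last level made of
  singletons.\<close>

definition shift :: "('i, 'j) network \<Rightarrow> ('i \<Rightarrow> 'j \<Rightarrow> real) \<Rightarrow> ('j \<times> 'j) set" where
  "shift M y = {(j, j'). \<exists>i\<in>users M. j \<in> route M i \<and> j' \<in> route M i \<and> 0 < y i j}"

definition load :: "('i, 'j) network \<Rightarrow> ('i \<Rightarrow> real) \<Rightarrow> ('i \<Rightarrow> 'j \<Rightarrow> real) \<Rightarrow> 'j \<Rightarrow> real" where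
  "load M n y j = (\<Sum>i | i \<in> users M \<and> j \<in> route M i. n i * y i j)"

definition users_on :: "('i, 'j) network \<Rightarrow> ('i \<Rightarrow> 'j \<Rightarrow> real) \<Rightarrow> 'j set \<Rightarrow> 'i set" where
  "users_on M y D = {i \<in> users M. \<exists>j\<in>D. j \<in> route M i \<and> 0 < y i j}"

definition resources_of :: "('i, 'j) network \<Rightarrow> ('i \<Rightarrow> 'j \<Rightarrow> real) \<Rightarrow> 'i set \<Rightarrow> 'j set" where
  "resources_of M y I = {j. \<exists>i\<in>I. j \<in> route M i \<and> 0 < y i j}"

definition component ::
  "('i, 'j) network \<Rightarrow> ('i \<Rightarrow> 'j \<Rightarrow> real) \<Rightarrow> 'i \<Rightarrow> 'i set \<times> 'j set" where
  "component M y i =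
     ((link M y)\<^sup>* `` {i}, resources_of M y ((link M y)\<^sup>* `` {i}))"

definition clusters_at ::
  "('i, 'j) network \<Rightarrow> ('i \<Rightarrow> real) \<Rightarrow> ('i \<Rightarrow> 'j \<Rightarrow> real) \<Rightarrow> ereal \<Rightarrow> ('i set \<times> 'j set) set" where
  "clusters_at M n y r =
     component M y ` {i \<in> active n (users M). ereal (rate M y i) = r} \<union>
     {({}, {j}) |j. r = \<infinity> \<and> j \<in> resources M \<and> users_on M y {j} = {}}"

lemma sum_load:
  assumes "finite (users M)" "finite A"
  shows "(\<Sum>j\<in>A. load M n y j) = (\<Sum>i\<in>users M. n i * (\<Sum>j\<in>A \<inter> route M i. y i j))"
proof -
  have "(\<Sum>j\<in>A. load M n y j) = (\<Sum>i\<in>users M. \<Sum>j | j \<in> A \<and> j \<in> route M i. n i * y i j)"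
    unfolding load_def by (rule sum.swap_restrict[OF assms(2,1)])
  also have "\<dots> = (\<Sum>i\<in>users M. n i * (\<Sum>j\<in>A \<inter> route M i. y i j))"
    by (simp add: sum_distrib_left Int_def)
  finally show ?thesis .
qed

locale flow_network =
  fixes N :: "('i, 'j) network" and n :: "'i \<Rightarrow> real"
  assumes wf: "wf_network N"
    and n_nonneg: "i \<in> users N \<Longrightarrow> 0 \<le> n i"
begin

lemma finite_users [simp]: "finite (users N)"
  and finite_resources [simp]: "finite (resources N)"
  using wf by (auto simp: wf_network_def)

lemma route_sub: "i \<in> users N \<Longrightarrow> route N i \<subseteq> resources N"
  and route_nonempty: "i \<in> users N \<Longrightarrow> route N i \<noteq> {}"
  and capacity_pos: "j \<in> resources N \<Longrightarrow> 0 < capacity N j"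
  using wf by (auto simp: wf_network_def)

lemma finite_route: "i \<in> users N \<Longrightarrow> finite (route N i)"
  using route_sub finite_resources finite_subset by blast

lemma feasible_iff:
  "feasible N n y \<longleftrightarrow> (\<forall>j\<in>resources N. load N n y j \<le> capacity N j) \<and>
     (\<forall>i\<in>users N. \<forall>j\<in>route N i. 0 \<le> y i j) \<and>
     (\<forall>i\<in>users N. n i = 0 \<longrightarrow> (\<forall>j\<in>route N i. y i j = 0))"
proof -
  have "rate N y i = 0 \<longleftrightarrow> (\<forall>j\<in>route N i. y i j = 0)"
    if "i \<in> users N" "\<forall>j\<in>route N i. 0 \<le> y i j" for i
    unfolding rate_def using that finite_route by (intro sum_nonneg_eq_0_iff) auto
  then show ?thesis unfolding feasible_def load_def by blast
qed

lemma active_if_pos: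
  assumes "feasible N n y" "i \<in> users N" "j \<in> route N i" "0 < y i j" shows "0 < n i"
proof -
  have "n i \<noteq> 0" using assms by (auto simp: feasible_iff)
  then show ?thesis using n_nonneg[OF assms(2)] by simp
qed

end

locale fair = flow_network M n
  for M :: "('i, 'j) network" and n :: "'i \<Rightarrow> real" +
  fixes y :: "'i \<Rightarrow> 'j \<Rightarrow> real"
  assumes feasible: "feasible M n y"
    and rate_pos: "i \<in> users M \<Longrightarrow> 0 < n i \<Longrightarrow> 0 < rate M y i"
    and saturated: "i \<in> users M \<Longrightarrow> 0 < n i \<Longrightarrow> j \<in> route M i \<Longrightarrow> load M n y j = capacity M j"
    and rate_le: "i \<in> users M \<Longrightarrow> 0 < n i \<Longrightarrow> i' \<in> users M \<Longrightarrow> j \<in> route M i \<Longrightarrow>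
      j \<in> route M i' \<Longrightarrow> 0 < y i' j \<Longrightarrow> rate M y i' \<le> rate M y i"
begin

lemma nonneg: "i \<in> users M \<Longrightarrow> j \<in> route M i \<Longrightarrow> 0 \<le> y i j"
  using feasible by (auto simp: feasible_def)

lemma load_le: "j \<in> resources M \<Longrightarrow> load M n y j \<le> capacity M j"
  using feasible by (auto simp: feasible_def load_def)

lemmas pos_imp_active = active_if_pos[OF feasible]

lemma active_iff_pos: "i \<in> users M \<Longrightarrow> 0 < n i \<longleftrightarrow> (\<exists>j\<in>route M i. 0 < y i j)"
proof
  assume "i \<in> users M" "0 < n i"
  then have "0 < (\<Sum>j\<in>route M i. y i j)" using rate_pos by (simp add: rate_def)
  then show "\<exists>j\<in>route M i. 0 < y i j" by (meson not_less sum_nonpos)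
qed (auto intro: pos_imp_active)

lemma rate_eq:
  assumes "i \<in> users M" "i' \<in> users M" "j \<in> route M i" "j \<in> route M i'" "0 < y i j" "0 < y i' j"
  shows "rate M y i' = rate M y i"
  using assms rate_le[of i i' j] rate_le[of i' i j] pos_imp_active by force

lemma saturated_used:
  assumes "i \<in> users M" "0 < n i" "j \<in> route M i"
  obtains i' where "i' \<in> users M" "j \<in> route M i'" "0 < y i' j"
proof -
  have "0 < load M n y j"
    using saturated[OF assms] capacity_pos route_sub assms by (metis subsetD)
  then obtain i' where "i' \<in> users M" "j \<in> route M i'" "0 < n i' * y i' j"
    unfolding load_def by (metis (mono_tags, lifting) linorder_not_le mem_Collect_eq sum_nonpos)
  then show ?thesis using that n_nonneg by (metis zero_less_mult_pos2 zero_less_mult_iff not_less)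
qed

context
  fixes \<rho> :: real
  assumes rho_le: "i \<in> users M \<Longrightarrow> 0 < n i \<Longrightarrow> \<rho> \<le> rate M y i"
begin

text \<open>Let \<open>s i\<close> be what user \<open>i\<close> draws from \<open>A\<close>. The
  sum of \<open>n i * s i\<close> is the load of \<open>A\<close>, hence at most its capacity, and
  it is bounded below term by term by \<open>h\<close>: a user with flows whose route lies within
  \<open>A\<close> draws its whole rate, at least \<rho>, from \<open>A\<close>. Equality of the
  ends forces equality in every term, so an outsider draws nothing from \<open>A\<close>, an insider
  with flows has rate \<rho>, and all of \<open>A\<close> is saturated.\<close>

lemma capacity_ge:
  assumes "A \<subseteq> resources M"
  shows "\<rho> * sum n (users_within M A) \<le> sum (capacity M) A"
    and "\<rho> * sum n (users_within M A) = sum (capacity M) A \<Longrightarrow>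
      i \<in> users M \<Longrightarrow> j \<in> A \<Longrightarrow> j \<in> route M i \<Longrightarrow> 0 < y i j \<Longrightarrow>
      i \<in> users_within M A \<and> rate M y i = \<rho>"
    and "\<rho> * sum n (users_within M A) = sum (capacity M) A \<Longrightarrow>
      j \<in> A \<Longrightarrow> load M n y j = capacity M j"
proof -
  have finA: "finite A" by (rule finite_subset[OF assms finite_resources])
  define s where "s i = (\<Sum>j\<in>A \<inter> route M i. y i j)" for i
  define h where "h i = (if i \<in> users_within M A then \<rho> * n i else 0)" for i
  have s0: "0 \<le> s i" if "i \<in> users M" for i
    unfolding s_def using nonneg that by (auto intro: sum_nonneg)
  have s_within: "s i = rate M y i" if "i \<in> users_within M A" for i
    using that by (auto simp: s_def rate_def users_within_def intro: arg_cong2[where f = sum])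
  have h_le: "h i \<le> n i * s i" if i: "i \<in> users M" for i
  proof (cases "n i = 0")
    case False
    then have "0 < n i" using n_nonneg[OF i] by simp
    then show ?thesis using s_within rho_le[OF i] s0[OF i] by (auto simp: h_def)
  qed (auto simp: h_def)
  have within: "users_within M A \<subseteq> users M" by (auto simp: users_within_def)
  have h_sum: "sum h (users M) = \<rho> * sum n (users_within M A)"
    using within unfolding h_def
    by (simp add: sum.If_cases sum_distrib_left Int_absorb1 flip: sum.inter_restrict)
  have eq: "(\<Sum>j\<in>A. load M n y j) = (\<Sum>i\<in>users M. n i * s i)"
    using sum_load[OF finite_users finA] by (simp add: s_def)
  have le: "(\<Sum>j\<in>A. load M n y j) \<le> sum (capacity M) A"
    using load_le assms by (intro sum_mono) auto
  have ge: "sum h (users M) \<le> (\<Sum>i\<in>users M. n i * s i)"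
    using h_le by (rule sum_mono)
  show "\<rho> * sum n (users_within M A) \<le> sum (capacity M) A"
    using le ge eq h_sum by linarith
  assume tight: "\<rho> * sum n (users_within M A) = sum (capacity M) A"
  have "(\<Sum>i\<in>users M. n i * s i - h i) = 0"
    using tight le ge eq h_sum by (simp add: sum_subtractf)
  then have h_eq: "n i * s i = h i" if "i \<in> users M" for i
    using that h_le by (subst (asm) sum_nonneg_eq_0_iff) auto
  have "(\<Sum>j\<in>A. capacity M j - load M n y j) = 0"
    using tight le ge eq h_sum by (simp add: sum_subtractf)
  then show "load M n y j = capacity M j" if "j \<in> A"
    using that load_le assms finA by (subst (asm) sum_nonneg_eq_0_iff) auto
  show "i \<in> users_within M A \<and> rate M y i = \<rho>"
    if "i \<in> users M" "j \<in> A" "j \<in> route M i" "0 < y i j"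
  proof -
    have n: "0 < n i" using that pos_imp_active by auto
    have "y i j \<le> s i"
      unfolding s_def using that finA nonneg by (intro member_le_sum) auto
    then have "0 < n i * s i" using n that(4) by simp
    then have "i \<in> users_within M A" using h_eq[OF that(1)] by (auto simp: h_def split: if_splits)
    moreover from this have "rate M y i = \<rho>"
      using h_eq[OF that(1)] n s_within by (simp add: h_def)
    ultimately show ?thesis ..
  qed
qed

end

end

section \<open>The lowest rate and the minimizers\<close>

definition bottleneck ::
  "('i, 'j) network \<Rightarrow> ('i \<Rightarrow> 'j \<Rightarrow> real) \<Rightarrow> real \<Rightarrow> 'j set" where
  "bottleneck M y \<rho> = resources_of M y {i \<in> users M. rate M y i = \<rho>}"

definition reach :: "('i, 'j) network \<Rightarrow> ('i \<Rightarrow> 'j \<Rightarrow> real) \<Rightarrow> 'j \<Rightarrow> 'j set" where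
  "reach M y j = (shift M y)\<^sup>* `` {j}"

definition mutual :: "('i, 'j) network \<Rightarrow> ('i \<Rightarrow> 'j \<Rightarrow> real) \<Rightarrow> 'j \<Rightarrow> 'j set" where
  "mutual M y j = {j'. (j, j') \<in> (shift M y)\<^sup>* \<and> (j', j) \<in> (shift M y)\<^sup>*}"

locale fair_lowest = fair M n y
  for M :: "('i, 'j) network" and n :: "'i \<Rightarrow> real" and y :: "'i \<Rightarrow> 'j \<Rightarrow> real" +
  fixes \<rho> :: real
  assumes rho_le: "i \<in> users M \<Longrightarrow> 0 < n i \<Longrightarrow> \<rho> \<le> rate M y i"
    and rho_attained: "\<exists>i\<in>users M. 0 < n i \<and> rate M y i = \<rho>"
begin

abbreviation "B \<equiv> bottleneck M y \<rho>"

lemma B_D: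
  assumes "j \<in> B"
  obtains i where "i \<in> users M" "j \<in> route M i" "0 < y i j" "rate M y i = \<rho>" "0 < n i"
  using assms pos_imp_active by (auto simp: bottleneck_def resources_of_def)

lemma B_I: "i \<in> users M \<Longrightarrow> j \<in> route M i \<Longrightarrow> 0 < y i j \<Longrightarrow> rate M y i = \<rho> \<Longrightarrow> j \<in> B"
  by (auto simp: bottleneck_def resources_of_def)

lemma B_sub: "B \<subseteq> resources M"
  using route_sub by (auto simp: bottleneck_def resources_of_def)

lemma B_rate:
  assumes "j \<in> B" "i \<in> users M" "j \<in> route M i" "0 < y i j" shows "rate M y i = \<rho>"
proof -
  obtain i' where "i' \<in> users M" "j \<in> route M i'" "0 < y i' j" "rate M y i' = \<rho>"
    using B_D[OF assms(1)] .
  then show ?thesis using rate_eq[of i' i j] assms by simp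
qed

text \<open>A resource on such a route is saturated, hence used by someone. Fairness bounds that
  user's rate by \<rho>, which is the least rate of any user with flows.\<close>

lemma route_sub_B:
  assumes i: "i \<in> users M" "0 < n i" and r: "rate M y i = \<rho>"
  shows "route M i \<subseteq> B"
proof
  fix j assume j: "j \<in> route M i"
  obtain i' where i': "i' \<in> users M" "j \<in> route M i'" "0 < y i' j"
    using saturated_used[OF i j] .
  have "rate M y i' \<le> \<rho>" using rate_le[OF i i'(1) j i'(2,3)] r by simp
  then have "rate M y i' = \<rho>" using rho_le i' pos_imp_active by force
  then show "j \<in> B" using B_I i' by blast
qed

lemma active_within_B:
  assumes "i \<in> users M" "0 < n i" shows "i \<in> users_within M B \<longleftrightarrow> rate M y i = \<rho>"
proof
  assume "i \<in> users_within M B"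
  moreover obtain j where "j \<in> route M i" "0 < y i j" using active_iff_pos assms by blast
  ultimately show "rate M y i = \<rho>" using B_rate assms by (auto simp: users_within_def)
qed (use assms route_sub_B in \<open>auto simp: users_within_def\<close>)

lemma reach_sub: assumes "j \<in> B" shows "reach M y j \<subseteq> B"
proof
  fix j' assume "j' \<in> reach M y j"
  then have "(j, j') \<in> (shift M y)\<^sup>*" by (simp add: reach_def)
  then show "j' \<in> B"
  proof (induction rule: rtrancl_induct)
    case (step k l)
    then obtain i where i: "i \<in> users M" "k \<in> route M i" "l \<in> route M i" "0 < y i k"
      by (auto simp: shift_def)
    then have "0 < n i" "rate M y i = \<rho>" using pos_imp_active B_rate step.IH by auto
    then show ?case using route_sub_B i by blast
  qed (rule assms)
qed

lemma self_in_reach: "j \<in> reach M y j"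
  by (simp add: reach_def)

lemma route_sub_reach:
  assumes "i \<in> users M" "k \<in> reach M y j" "k \<in> route M i" "0 < y i k"
  shows "route M i \<subseteq> reach M y j"
proof
  fix l assume "l \<in> route M i"
  then have "(k, l) \<in> shift M y" using assms by (auto simp: shift_def)
  then show "l \<in> reach M y j"
    using assms(2) by (auto simp: reach_def intro: rtrancl.rtrancl_into_rtrancl)
qed

text \<open>This is the ratio being \<rho>, with the denominator multiplied out. A nonempty set of
  resources without flows inside has infinite ratio, and it is not tight either because its capacity
  is positive.\<close>

definition tight :: "'j set \<Rightarrow> bool" where
  "tight S \<longleftrightarrow> \<rho> * sum n (users_within M S) = sum (capacity M) S"

lemma B_load: assumes "j \<in> B" shows "load M n y j = capacity M j"
  using B_D[OF assms] saturated by blast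

text \<open>The load is counted user by user. The reach is closed under arrows, so whoever draws
  from it has its whole route inside; conversely, a user with flows whose route lies inside draws
  from \<open>B\<close> and has rate \<rho>. All of \<open>B\<close> is saturated.\<close>

lemma reach_tight: assumes j: "j \<in> B" shows "tight (reach M y j)"
proof -
  let ?D = "reach M y j"
  have D: "?D \<subseteq> resources M" using reach_sub[OF j] B_sub by blast
  then have fin: "finite ?D" by (rule finite_subset) simp
  have *: "n i * (\<Sum>k\<in>?D \<inter> route M i. y i k) = (if i \<in> users_within M ?D then \<rho> * n i else 0)"
    if i: "i \<in> users M" for i
  proof (cases "i \<in> users_within M ?D \<and> 0 < n i")
    case True
    then have sub: "route M i \<subseteq> ?D" by (simp add: users_within_def)
    obtain k where "k \<in> route M i" "0 < y i k" using active_iff_pos i True by blast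
    then have "rate M y i = \<rho>" using B_rate sub reach_sub[OF j] i by blast
    then show ?thesis using sub True by (simp add: rate_def Int_absorb1)
  next
    case False
    have "y i k = 0" if "k \<in> ?D \<inter> route M i" "0 < n i" for k
    proof (rule ccontr)
      assume "y i k \<noteq> 0"
      then have "0 < y i k" using nonneg i that by force
      then show False using route_sub_reach i that False by (auto simp: users_within_def)
    qed
    then show ?thesis using False n_nonneg[OF i] by (cases "n i = 0") auto
  qed
  have "sum (capacity M) ?D = (\<Sum>k\<in>?D. load M n y k)"
    using B_load reach_sub[OF j] by (intro sum.cong) auto
  also have "\<dots> = (\<Sum>i\<in>users M. if i \<in> users_within M ?D then \<rho> * n i else 0)"
    using sum_load[OF finite_users fin] * by simp
  also have "\<dots> = \<rho> * sum n (users_within M ?D)"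
    by (simp add: sum.If_cases sum_distrib_left Int_absorb1 users_within_def Collect_conj_eq)
  finally show ?thesis by (simp add: tight_def)
qed

text \<open>By \<open>capacity_ge\<close>, a user who draws from a tight set has its whole route
  there. So tight sets are closed under arrows.\<close>

lemma reach_least:
  assumes S: "S \<subseteq> resources M" "tight S" "j \<in> S"
  shows "reach M y j \<subseteq> S"
proof
  fix k assume "k \<in> reach M y j"
  then have "(j, k) \<in> (shift M y)\<^sup>*" by (simp add: reach_def)
  then show "k \<in> S"
  proof (induction rule: rtrancl_induct)
    case (step k l)
    then obtain i where i: "i \<in> users M" "k \<in> route M i" "l \<in> route M i" "0 < y i k"
      by (auto simp: shift_def)
    then have "i \<in> users_within M S"
      using capacity_ge(2)[OF rho_le S(1), of i k] S(2) step.IH by (auto simp: tight_def)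
    then show ?case using i by (auto simp: users_within_def)
  qed (rule S)
qed

text \<open>In a separation of the reach, the part containing \<open>j\<close> absorbs every arrow
  that leaves it: the user behind the arrow has its route inside the reach, so it is assigned to one
  side and cannot touch the other.\<close>

lemma reach_strongly_connected:
  assumes j: "j \<in> B" shows "reach M y j \<in> strongly_connected M"
proof -
  let ?D = "reach M y j"
  have D: "?D \<subseteq> resources M" using reach_sub[OF j] B_sub by blast
  \<comment> \<open>Stated for the side that contains \<open>j\<close>; it is applied below with the
    two parts in either order.\<close>
  have split: "J2 = {}"
    if J: "j \<in> J1" "J1 \<union> J2 = ?D" "J1 \<inter> J2 = {}" and I: "I1 \<union> I2 = users_within M ?D"
      "\<forall>i\<in>I1. route M i \<inter> J2 = {}" "\<forall>i\<in>I2. route M i \<inter> J1 = {}" for J1 J2 I1 I2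
  proof -
    have "k \<in> J1" if "(j, k) \<in> (shift M y)\<^sup>*" for k
      using that
    proof (induction rule: rtrancl_induct)
      case (step k l)
      then obtain i where i: "i \<in> users M" "k \<in> route M i" "l \<in> route M i" "0 < y i k"
        by (auto simp: shift_def)
      then have "route M i \<subseteq> ?D" using route_sub_reach step.IH J(2) by blast
      then have "i \<in> I1" "l \<in> ?D"
        using i step.IH I by (auto simp: users_within_def)
      then show ?case using I(2) i J(2) by blast
    qed (use J in simp)
    then have "?D \<subseteq> J1" by (auto simp: reach_def)
    then show ?thesis using J by blast
  qed
  have "connected_pair M (users_within M ?D) ?D"
    unfolding connected_pair_def
  proof (intro notI, elim exE conjE)
    fix J1 J2 I1 I2
    assume *: "J1 \<noteq> {}" "J2 \<noteq> {}" "J1 \<union> J2 = ?D" "J1 \<inter> J2 = {}" "I1 \<union> I2 = users_within M ?D"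
      "I1 \<inter> I2 = {}" "\<forall>i\<in>I1. route M i \<inter> J2 = {}" "\<forall>i\<in>I2. route M i \<inter> J1 = {}"
    then have "J2 \<union> J1 = ?D" "J2 \<inter> J1 = {}" "I2 \<union> I1 = users_within M ?D" by blast+
    then have "j \<notin> J1" "j \<notin> J2" using split * by metis+
    then show False using self_in_reach *(3) by blast
  qed
  then show ?thesis using D self_in_reach by (auto simp: strongly_connected_def)
qed

lemma finite_strongly_connected: "finite (strongly_connected M)"
  by (rule finite_subset[of _ "Pow (resources M)"]) (auto simp: strongly_connected_def)

lemma sum_n_nonneg: "0 \<le> sum n (users_within M S)"
  using n_nonneg by (auto intro!: sum_nonneg simp: users_within_def)

lemma ratio_ge:
  assumes "S \<in> strongly_connected M"
  shows "ereal \<rho> \<le> ratio M n (users_within M S) S"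
proof (cases "sum n (users_within M S) = 0")
  case False
  then have "0 < sum n (users_within M S)" using sum_n_nonneg[of S] by simp
  moreover have "\<rho> * sum n (users_within M S) \<le> sum (capacity M) S"
    using assms by (intro capacity_ge(1) rho_le) (auto simp: strongly_connected_def)
  ultimately show ?thesis by (simp add: ratio_def pos_le_divide_eq)
qed (simp add: ratio_def)

lemma ratio_eq_iff:
  assumes "S \<in> strongly_connected M"
  shows "ratio M n (users_within M S) S = ereal \<rho> \<longleftrightarrow> tight S"
proof (cases "sum n (users_within M S) = 0")
  case True
  have S: "S \<noteq> {}" "S \<subseteq> resources M" using assms by (auto simp: strongly_connected_def)
  then have "finite S" using finite_subset[OF S(2) finite_resources] by simp
  then have "0 < sum (capacity M) S" using S capacity_pos by (intro sum_pos) auto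
  then show ?thesis using True by (simp add: ratio_def tight_def)
next
  case False
  then show ?thesis by (auto simp: ratio_def tight_def nonzero_divide_eq_eq)
qed

text \<open>\<open>capacity_ge\<close> gives the lower bound. The reach of any resource on the route
  of a user with the lowest rate attains it.\<close>

lemma min_ratio_eq: "min_ratio M n = ereal \<rho>"
proof -
  obtain i where i: "i \<in> users M" "0 < n i" "rate M y i = \<rho>" using rho_attained by blast
  then obtain j where "j \<in> route M i" using route_nonempty by blast
  then have "j \<in> B" using route_sub_B i by blast
  have *: "reach M y j \<in> strongly_connected M"
    by (rule reach_strongly_connected) fact
  have "ratio M n (users_within M (reach M y j)) (reach M y j) = ereal \<rho>"
    using ratio_eq_iff[OF *] reach_tight[OF \<open>j \<in> B\<close>] by blast
  note * = * this[symmetric]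
  show ?thesis
    unfolding min_ratio_def
  proof (rule Min_eqI)
    show "finite ((\<lambda>J'. ratio M n (users_within M J') J') ` strongly_connected M)"
      using finite_strongly_connected by simp
    show "ereal \<rho> \<in> (\<lambda>J'. ratio M n (users_within M J') J') ` strongly_connected M"
      by (rule image_eqI[where x = "reach M y j"]) (rule *)+
    next
    fix r assume "r \<in> (\<lambda>J'. ratio M n (users_within M J') J') ` strongly_connected M"
    then show "ereal \<rho> \<le> r" using ratio_ge by blast
  qed
qed

lemma minimizers_iff: "S \<in> minimizers M n \<longleftrightarrow> S \<in> strongly_connected M \<and> tight S"
  using ratio_eq_iff[of S] by (auto simp: minimizers_def min_ratio_eq)

text \<open>A tight set is saturated, so each of its resources, having positive capacity, serves
  somebody; tightness gives that user the rate \<rho>.\<close>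

lemma minimizer_sub: assumes "S \<in> minimizers M n" shows "S \<subseteq> B"
proof
  fix j assume j: "j \<in> S"
  have S: "S \<subseteq> resources M" and t: "\<rho> * sum n (users_within M S) = sum (capacity M) S"
    using assms by (auto simp: minimizers_iff strongly_connected_def tight_def)
  have "0 < load M n y j"
    using capacity_ge(3)[OF rho_le S t j] capacity_pos j S by auto
  then obtain i where i: "i \<in> users M" "j \<in> route M i" "0 < n i * y i j"
    unfolding load_def by (metis (mono_tags, lifting) linorder_not_le mem_Collect_eq sum_nonpos)
  then have "0 < y i j" using n_nonneg[OF i(1)] by (simp add: zero_less_mult_iff)
  then show "j \<in> B" using capacity_ge(2)[OF rho_le S t i(1) j i(2)] i by (intro B_I) auto
qed

lemma reach_minimizer: "j \<in> B \<Longrightarrow> reach M y j \<in> minimizers M n"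
  by (simp add: minimizers_iff reach_strongly_connected reach_tight)

lemma step_resources_eq: "step_resources M n = B"
  unfolding step_resources_def
proof (intro equalityI subsetI)
  show "j \<in> \<Union> (minimizers M n)" if "j \<in> B" for j
    by (rule UnionI[OF reach_minimizer[OF that] self_in_reach])
qed (use minimizer_sub in blast)

lemma reach_sub_minimizer: "S \<in> minimizers M n \<Longrightarrow> j \<in> S \<Longrightarrow> reach M y j \<subseteq> S"
  by (rule reach_least) (auto simp: minimizers_iff strongly_connected_def)

text \<open>\<open>reach M y j\<close> is a minimizer inside \<open>S\<close>. Were it a proper part
  of \<open>S\<close>, it would be one of the smaller minimizers, and \<open>j\<close> would not be
  owned by \<open>S\<close>.\<close>

lemma own_resources_reach:
  assumes "S \<in> minimizers M n" "j \<in> own_resources M n S"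
  shows "S = reach M y j" "j \<in> B"
proof -
  have "j \<in> S" using assms by (simp add: own_resources_def)
  then show "j \<in> B" using minimizer_sub assms(1) by blast
  then have "reach M y j \<in> minimizers M n" by (rule reach_minimizer)
  then show "S = reach M y j"
    using reach_sub_minimizer[OF assms(1) \<open>j \<in> S\<close>] assms(2) self_in_reach
    by (auto simp: own_resources_def smaller_minimizers_def)
qed

lemma mutual_iff: "j' \<in> mutual M y j \<longleftrightarrow> reach M y j' = reach M y j"
proof
  assume "j' \<in> mutual M y j"
  then show "reach M y j' = reach M y j"
    by (auto simp: mutual_def reach_def intro: rtrancl_trans)
next
  assume "reach M y j' = reach M y j"
  then show "j' \<in> mutual M y j"
    using self_in_reach[of j] self_in_reach[of j'] by (auto simp: mutual_def reach_def)
qed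

text \<open>Every minimizer containing \<open>k\<close> contains the reach of \<open>k\<close>, so
  \<open>k\<close> is owned by its own reach. Being owned by the reach of \<open>j\<close> thus
  means having the same reach as \<open>j\<close>, which is mutual reachability.\<close>

lemma own_reach: assumes "j \<in> B" shows "own_resources M n (reach M y j) = mutual M y j"
proof -
  have self: "k \<in> own_resources M n (reach M y k)" for k
    using reach_sub_minimizer[of _ k] self_in_reach[of k]
    by (auto simp: own_resources_def smaller_minimizers_def)
  show ?thesis
  proof (intro equalityI subsetI)
    fix k assume "k \<in> own_resources M n (reach M y j)"
    then show "k \<in> mutual M y j"
      using own_resources_reach(1)[OF reach_minimizer[OF assms]] unfolding mutual_iff by blast
  next
    fix k assume "k \<in> mutual M y j"
    then show "k \<in> own_resources M n (reach M y j)" using self[of k] by (simp add: mutual_iff)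
  qed
qed

text \<open>A user who draws from a smaller minimizer lies within it, by tightness, and is not an
  own user. So own users with flows draw from the own part only.\<close>

lemma own_users_reach:
  assumes j: "j \<in> B"
  shows "active n (own_users M n (reach M y j)) = users_on M y (mutual M y j)" (is "?l = ?r")
proof
  have own: "own_resources M n (reach M y j) = mutual M y j" by (rule own_reach[OF j])
  show "?l \<subseteq> ?r"
  proof
    fix i assume i: "i \<in> ?l"
    then have iu: "i \<in> users M" "0 < n i" "route M i \<subseteq> reach M y j"
      by (auto simp: active_def own_users_def users_within_def)
    then obtain k where k: "k \<in> route M i" "0 < y i k" using active_iff_pos by blast
    have "k \<notin> S" if S: "S \<in> smaller_minimizers M n (reach M y j)" for S
    proof
      assume "k \<in> S"
      then have "i \<in> users_within M S"
        using S iu k capacity_ge(2)[OF rho_le, of S i k]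
        by (auto simp: smaller_minimizers_def minimizers_iff strongly_connected_def tight_def)
      then show False using i S by (auto simp: active_def own_users_def)
    qed
    then have "k \<in> mutual M y j" using own k iu by (auto simp: own_resources_def)
    then show "i \<in> ?r" using k iu by (auto simp: users_on_def)
  qed
  show "?r \<subseteq> ?l"
  proof
    fix i assume "i \<in> ?r"
    then obtain k where k: "i \<in> users M" "k \<in> mutual M y j" "k \<in> route M i" "0 < y i k"
      by (auto simp: users_on_def)
    then have "k \<in> own_resources M n (reach M y j)" using own by simp
    then have "i \<notin> users_within M S" if "S \<in> smaller_minimizers M n (reach M y j)" for S
      using that k by (auto simp: own_resources_def users_within_def)
    moreover have "route M i \<subseteq> reach M y j"
      using route_sub_reach[of i k j] k by (auto simp: mutual_def reach_def)
    ultimately show "i \<in> ?l"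
      using k pos_imp_active by (auto simp: active_def own_users_def users_within_def)
  qed
qed

text \<open>The minimizers with a nonempty own part are exactly the reaches of resources in
  \<open>B\<close>. A minimizer that is merely a union of smaller ones yields no cluster, hence the
  side condition.\<close>

lemma minimizers_own:
  "(\<lambda>S. (active n (own_users M n S), own_resources M n S)) `
     {S \<in> minimizers M n. own_resources M n S \<noteq> {}} =
   (\<lambda>j. (users_on M y (mutual M y j), mutual M y j)) ` B" (is "?f ` ?S = ?g ` B")
proof -
  have "?f S \<in> ?g ` B" if S: "S \<in> ?S" for S
  proof -
    obtain j where "j \<in> own_resources M n S" "S \<in> minimizers M n" using S by blast
    from own_resources_reach[OF this(2,1)] show ?thesis
      using own_reach own_users_reach by auto
  qed
  moreover have "?g j \<in> ?f ` ?S" if "j \<in> B" for j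
  proof
    show "?g j = ?f (reach M y j)" using that by (simp add: own_reach own_users_reach)
    have "j \<in> mutual M y j" by (simp add: mutual_def)
    then show "reach M y j \<in> ?S" using that by (auto simp: own_reach reach_minimizer)
  qed
  ultimately show ?thesis by blast
qed

end

section \<open>Links, arrows and recurrence\<close>

locale recurrent_fair = fair M n y
  for M :: "('i, 'j) network" and n :: "'i \<Rightarrow> real" and y :: "'i \<Rightarrow> 'j \<Rightarrow> real" +
  assumes recurrent: "i \<in> users M \<Longrightarrow> j \<in> route M i \<Longrightarrow> 0 < y i j \<Longrightarrow> j' \<in> route M i \<Longrightarrow>
    (j', j) \<in> (shift M y)\<^sup>* \<Longrightarrow> 0 < y i j'"
begin

lemma link_shift:
  assumes "(i, i') \<in> link M y" "j \<in> route M i" "0 < y i j" "j' \<in> route M i'" "0 < y i' j'"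
  shows "(j, j') \<in> (shift M y)\<^sup>*"
proof -
  obtain k where "k \<in> route M i" "k \<in> route M i'" "0 < y i' k" "i \<in> users M" "i' \<in> users M"
    using assms(1) by (auto simp: link_def)
  then have "(j, k) \<in> shift M y" "(k, j') \<in> shift M y" using assms by (auto simp: shift_def)
  then show ?thesis by (meson converse_rtrancl_into_rtrancl r_into_rtrancl)
qed

lemma link_sym: "sym (link M y)"
  by (auto simp: sym_def link_def)

lemma link_users: "(i, i') \<in> (link M y)\<^sup>* \<Longrightarrow> i \<in> users M \<Longrightarrow> i' \<in> users M"
  by (induction rule: rtrancl_induct) (auto simp: link_def)

lemma link_rate: "(i, i') \<in> (link M y)\<^sup>* \<Longrightarrow> rate M y i' = rate M y i"
  by (induction rule: rtrancl_induct) (auto simp: link_def dest: rate_eq)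

lemma link_rtrancl_shift:
  assumes "(i, i') \<in> (link M y)\<^sup>*" "i \<in> users M"
    "j \<in> route M i" "0 < y i j" "j' \<in> route M i'" "0 < y i' j'"
  shows "(j, j') \<in> (shift M y)\<^sup>*"
  using assms
proof (induction arbitrary: j' rule: rtrancl_induct)
  case base
  then show ?case by (auto simp: shift_def)
next
  case (step k l)
  then obtain m where m: "m \<in> route M k" "0 < y k m" by (auto simp: link_def)
  show ?case
    using step.IH[OF step.prems(1-3) m] link_shift[OF step.hyps(2) m step.prems(4,5)] by simp
qed

text \<open>Induction along the path from \<open>j\<close>. Its first arrow lies on a cycle, since
  \<open>j'\<close> leads back to \<open>j\<close>; by recurrence the user \<open>h\<close> behind
  this arrow draws from both of its ends. So \<open>i\<close> is linked to \<open>h\<close> through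
  \<open>j\<close>, and \<open>h\<close> takes over the role of \<open>i\<close> at the next
  resource \<open>k\<close>.\<close>

lemma mutual_link:
  assumes "(j, j') \<in> (shift M y)\<^sup>*" "(j', j) \<in> (shift M y)\<^sup>*"
    "i \<in> users M" "j \<in> route M i" "0 < y i j" "i' \<in> users M" "j' \<in> route M i'" "0 < y i' j'"
  shows "(i, i') \<in> (link M y)\<^sup>*"
  using assms
proof (induction arbitrary: i rule: converse_rtrancl_induct)
  case base
  then show ?case by (auto simp: link_def)
next
  case (step j k)
  then obtain h where h: "h \<in> users M" "j \<in> route M h" "k \<in> route M h" "0 < y h j"
    by (auto simp: shift_def)
  have "(k, j) \<in> (shift M y)\<^sup>*" using step.hyps(2) step.prems(1) by simp
  then have "0 < y h k" using recurrent h by blast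
  moreover have "(j', k) \<in> (shift M y)\<^sup>*"
    using step.prems(1) step.hyps(1) by simp
  ultimately have "(h, i') \<in> (link M y)\<^sup>*" using step h by blast
  moreover have "(i, h) \<in> link M y" using step.prems h by (auto simp: link_def)
  ultimately show ?case by simp
qed

lemma component_eq:
  assumes i: "i \<in> users M" "j \<in> route M i" "0 < y i j"
  shows "component M y i = (users_on M y (mutual M y j), mutual M y j)"
proof -
  have u: "(link M y)\<^sup>* `` {i} = users_on M y (mutual M y j)"
  proof (intro equalityI subsetI)
    fix i' assume "i' \<in> (link M y)\<^sup>* `` {i}"
    then have l: "(i, i') \<in> (link M y)\<^sup>*" by simp
    then have l': "(i', i) \<in> (link M y)\<^sup>*" using link_sym by (meson symD sym_rtrancl)
    have i': "i' \<in> users M" using link_users l i by blast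
    have "\<exists>j'\<in>route M i'. 0 < y i' j'"
      using l by (cases rule: rtranclE) (use i in \<open>auto simp: link_def\<close>)
    then obtain j' where j': "j' \<in> route M i'" "0 < y i' j'" by blast
    then show "i' \<in> users_on M y (mutual M y j)"
      using link_rtrancl_shift[OF l i j'] link_rtrancl_shift[OF l' i' j' i(2,3)] i'
      by (auto simp: users_on_def mutual_def)
  next
    fix i' assume "i' \<in> users_on M y (mutual M y j)"
    then show "i' \<in> (link M y)\<^sup>* `` {i}"
      using mutual_link[of j _ i i'] i by (auto simp: users_on_def mutual_def)
  qed
  have "resources_of M y (users_on M y (mutual M y j)) = mutual M y j"
  proof (intro equalityI subsetI)
    fix k assume "k \<in> resources_of M y (users_on M y (mutual M y j))"
    then obtain i' l where *: "i' \<in> users M" "l \<in> mutual M y j" "l \<in> route M i'" "0 < y i' l"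
      "k \<in> route M i'" "0 < y i' k"
      by (auto simp: resources_of_def users_on_def)
    then have "(l, k) \<in> shift M y" "(k, l) \<in> shift M y" by (auto simp: shift_def)
    then show "k \<in> mutual M y j"
      using *(2) by (auto simp: mutual_def intro: rtrancl_into_rtrancl converse_rtrancl_into_rtrancl)
  next
    fix k assume k: "k \<in> mutual M y j"
    then have "(k, j) \<in> (shift M y)\<^sup>*" by (simp add: mutual_def)
    \<comment> \<open>On an empty path \<open>k\<close> is \<open>j\<close>, from which
      \<open>i\<close> draws; otherwise the user behind the first arrow draws from
      \<open>k\<close>.\<close>
    then have "\<exists>i'\<in>users M. k \<in> route M i' \<and> 0 < y i' k"
      by (cases rule: converse_rtranclE) (use i in \<open>auto simp: shift_def\<close>)
    then show "k \<in> resources_of M y (users_on M y (mutual M y j))"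
      using k by (auto simp: resources_of_def users_on_def)
  qed
  then show ?thesis using u by (simp add: component_def)
qed

end

section \<open>One step of the algorithm\<close>

definition levels ::
  "('i, 'j) network \<Rightarrow> ('i \<Rightarrow> real) \<Rightarrow> ('i \<Rightarrow> 'j \<Rightarrow> real) \<Rightarrow> ereal set" where
  "levels M n y = {s. clusters_at M n y s \<noteq> {}}"

text \<open>Without flows all ratios are infinite, so every strongly connected set is a minimizer.
  The singletons are among them and cover every larger set, which leaves only singletons with a
  nonempty own part.\<close>

lemma (in fair) no_active:
  assumes idle: "active n (users M) = {}" and "resources M \<noteq> {}"
  shows "min_ratio M n = \<infinity>" "step_resources M n = resources M"
    "{S \<in> minimizers M n. own_resources M n S \<noteq> {}} = (\<lambda>j. {j}) ` resources M"
    "j \<in> resources M \<Longrightarrow> own_resources M n {j} = {j}"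
proof -
  have "n i = 0" if "i \<in> users M" for i
    using idle n_nonneg[OF that] that by (force simp: active_def)
  then have ratio: "ratio M n (users_within M S) S = \<infinity>" for S
    by (simp add: ratio_def users_within_def)
  have single: "{j} \<in> strongly_connected M" if "j \<in> resources M" for j
    using that by (auto simp: strongly_connected_def connected_pair_def Un_singleton_iff)
  then have "strongly_connected M \<noteq> {}" using assms(2) by blast
  then show mr: "min_ratio M n = \<infinity>" by (simp add: min_ratio_def ratio image_constant_conv)
  have min: "minimizers M n = strongly_connected M" by (simp add: minimizers_def mr ratio)
  show "step_resources M n = resources M"
    using single by (auto simp: step_resources_def min strongly_connected_def)
  show own: "own_resources M n {j} = {j}" if "j \<in> resources M" for j
    by (auto simp: own_resources_def smaller_minimizers_def min strongly_connected_def)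
  have "S = {j}" if "S \<in> strongly_connected M" "j \<in> own_resources M n S" for S j
  proof (rule ccontr)
    assume "S \<noteq> {j}"
    then have "{j} \<in> smaller_minimizers M n S"
      using that single
      by (auto simp: own_resources_def smaller_minimizers_def min strongly_connected_def)
    then show False using that(2) by (auto simp: own_resources_def)
  qed
  then show "{S \<in> minimizers M n. own_resources M n S \<noteq> {}} = (\<lambda>j. {j}) ` resources M"
    using single own unfolding min by (auto simp: strongly_connected_def)
qed

context recurrent_fair
begin

lemma step_cases:
  assumes "resources M \<noteq> {}"
  obtains (low) \<rho> where "fair_lowest M n y \<rho>"
  | (idle) "active n (users M) = {}"
proof (cases "active n (users M) = {}")
  case False
  let ?R = "rate M y ` active n (users M)"
  have fin: "finite ?R" and ne: "?R \<noteq> {}" using False by (auto simp: active_def)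
  have "fair_lowest M n y (Min ?R)"
  proof
    show "Min ?R \<le> rate M y i" if "i \<in> users M" "0 < n i" for i
      using fin that by (auto simp: active_def)
    show "\<exists>i\<in>users M. 0 < n i \<and> rate M y i = Min ?R"
      using Min_in[OF fin ne] by (auto simp: active_def)
  qed
  then show ?thesis by (rule that(1))
qed (rule that(2))

text \<open>By \<open>component_eq\<close>, the components at the lowest rate are the classes of
  mutual reachability in \<open>B\<close>, which \<open>minimizers_own\<close> matches with the own
  parts. Without flows, both sides consist of the singletons paired with no users.\<close>

lemma clusters_at_own:
  assumes "resources M \<noteq> {}"
  shows "clusters_at M n y (min_ratio M n) =
    (\<lambda>S. (active n (own_users M n S), own_resources M n S)) `
      {S \<in> minimizers M n. own_resources M n S \<noteq> {}}"
  using assms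
proof (cases rule: step_cases)
  case (low \<rho>)
  interpret fair_lowest M n y \<rho> by fact
  let ?g = "\<lambda>j. (users_on M y (mutual M y j), mutual M y j)"
  have "component M y ` {i \<in> active n (users M). rate M y i = \<rho>} = ?g ` B"
  proof (intro equalityI subsetI)
    fix p assume "p \<in> component M y ` {i \<in> active n (users M). rate M y i = \<rho>}"
    then obtain i where i: "i \<in> users M" "0 < n i" "rate M y i = \<rho>" "p = component M y i"
      by (auto simp: active_def)
    then obtain j where "j \<in> route M i" "0 < y i j" using active_iff_pos by blast
    then show "p \<in> ?g ` B" using component_eq B_I i by blast
  next
    fix p assume "p \<in> ?g ` B"
    then obtain j where "j \<in> B" "p = ?g j" by blast
    moreover from \<open>j \<in> B\<close> obtain i where
      "i \<in> users M" "j \<in> route M i" "0 < y i j" "rate M y i = \<rho>" "0 < n i" by (rule B_D)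
    ultimately show "p \<in> component M y ` {i \<in> active n (users M). rate M y i = \<rho>}"
      using component_eq[of i j] by (intro image_eqI[where x = i]) (auto simp: active_def)
  qed
  then show ?thesis unfolding minimizers_own by (simp add: clusters_at_def min_ratio_eq)
next
  case idle
  note * = no_active[OF idle assms]
  have "active n (own_users M n S) = {}" for S
    using idle by (auto simp: active_def own_users_def users_within_def)
  moreover have "users_on M y {j} = {}" for j
    using idle pos_imp_active by (auto simp: users_on_def active_def)
  ultimately show ?thesis
    using idle by (auto simp: clusters_at_def *(1,3,4) image_image)
qed

lemma step_resources_sub: "step_resources M n \<subseteq> resources M"
  by (auto simp: step_resources_def minimizers_def strongly_connected_def)

lemma step_users_iff_rate:
  assumes "i \<in> users M" "0 < n i"
  shows "i \<in> step_users M n \<longleftrightarrow> ereal (rate M y i) = min_ratio M n"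
    and "min_ratio M n \<le> ereal (rate M y i)"
proof -
  have ne: "resources M \<noteq> {}" using assms route_sub route_nonempty by blast
  have "(i \<in> step_users M n \<longleftrightarrow> ereal (rate M y i) = min_ratio M n) \<and>
    min_ratio M n \<le> ereal (rate M y i)"
    using ne
  proof (cases rule: step_cases)
    case (low \<rho>)
    interpret fair_lowest M n y \<rho> by fact
    show ?thesis
      using active_within_B assms rho_le by (auto simp: step_users_def step_resources_eq min_ratio_eq)
  qed (use assms in \<open>auto simp: active_def\<close>)
  then show "i \<in> step_users M n \<longleftrightarrow> ereal (rate M y i) = min_ratio M n"
    and "min_ratio M n \<le> ereal (rate M y i)" by auto
qed

text \<open>The cut made by a step is clean: nobody draws from both removed and remaining resources,
  which is what lets the same \<open>y\<close> serve the reduced network. The reason is that all who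
  draw from a resource in the bottleneck have the lowest rate.\<close>

lemma step_users_iff_used:
  assumes "i \<in> users M" "j \<in> route M i" "0 < y i j"
  shows "i \<in> step_users M n \<longleftrightarrow> j \<in> step_resources M n"
proof
  show "j \<in> step_resources M n" if "i \<in> step_users M n"
    using that assms by (auto simp: step_users_def users_within_def)
  assume j: "j \<in> step_resources M n"
  have "resources M \<noteq> {}" using assms route_sub by blast
  then show "i \<in> step_users M n"
  proof (cases rule: step_cases)
    case (low \<rho>)
    interpret fair_lowest M n y \<rho> by fact
    have "rate M y i = \<rho>" using j assms B_rate by (simp add: step_resources_eq)
    then show ?thesis
      using step_users_iff_rate(1) assms pos_imp_active by (simp add: min_ratio_eq)
  qed (use assms pos_imp_active in \<open>auto simp: active_def\<close>)
qed

text \<open>A resource without traffic is never in the bottleneck, so it stays until no flows are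
  left and the minimum becomes infinite.\<close>

lemma unused_step:
  assumes "j \<in> resources M" "users_on M y {j} = {}"
  shows "j \<in> step_resources M n \<longleftrightarrow> min_ratio M n = \<infinity>"
proof -
  have ne: "resources M \<noteq> {}" using assms by blast
  then show ?thesis
  proof (cases rule: step_cases)
    case (low \<rho>)
    interpret fair_lowest M n y \<rho> by fact
    have "j \<notin> B" using assms(2) by (auto simp: users_on_def bottleneck_def resources_of_def)
    then show ?thesis by (simp add: step_resources_eq min_ratio_eq)
  qed (use assms no_active[OF _ ne] in auto)
qed

lemma Union_clusters_at:
  shows "\<Union> (fst ` clusters_at M n y (min_ratio M n)) = active n (step_users M n)"
    and "\<Union> (snd ` clusters_at M n y (min_ratio M n)) = step_resources M n"
proof -
  let ?r = "min_ratio M n"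
  have comp: "i' \<in> active n (step_users M n)"
    if "i \<in> users M" "0 < n i" "ereal (rate M y i) = ?r" "(i, i') \<in> (link M y)\<^sup>*" for i i'
  proof -
    have "i' \<in> users M" "rate M y i' = rate M y i" using that link_users link_rate by auto
    \<comment> \<open>By feasibility a user without flows has rate zero, but the rate is constant
      along links and that of \<open>i\<close> is positive.\<close>
    moreover have "0 < n i'"
      using rate_pos[OF that(1,2)] calculation n_nonneg[of i'] feasible
      by (force simp: feasible_def)
    ultimately show ?thesis using that step_users_iff_rate(1)[of i'] by (auto simp: active_def)
  qed
  have step: "i \<in> users M \<and> 0 < n i \<and> ereal (rate M y i) = ?r"
    if "i \<in> active n (step_users M n)" for i
    using that step_users_iff_rate(1) by (auto simp: active_def step_users_def users_within_def)
  show "\<Union> (fst ` clusters_at M n y ?r) = active n (step_users M n)"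
  proof (intro equalityI subsetI)
    fix i assume "i \<in> \<Union> (fst ` clusters_at M n y ?r)"
    then show "i \<in> active n (step_users M n)"
      using comp by (auto simp: clusters_at_def component_def active_def)
  next
    fix i assume "i \<in> active n (step_users M n)"
    from step[OF this] show "i \<in> \<Union> (fst ` clusters_at M n y ?r)"
      by (auto simp: clusters_at_def component_def active_def)
  qed
  show "\<Union> (snd ` clusters_at M n y ?r) = step_resources M n"
  proof (intro equalityI subsetI)
    fix j assume "j \<in> \<Union> (snd ` clusters_at M n y ?r)"
    then consider i i' where "i \<in> users M" "0 < n i" "ereal (rate M y i) = ?r"
        "(i, i') \<in> (link M y)\<^sup>*" "j \<in> route M i'" "0 < y i' j"
      | "?r = \<infinity>" "j \<in> resources M" "users_on M y {j} = {}"
      by (auto simp: clusters_at_def component_def active_def resources_of_def)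
    then show "j \<in> step_resources M n"
    proof cases
      case 1
      have i': "i' \<in> active n (step_users M n)" by (rule comp[OF 1(1-4)])
      then have "i' \<in> users M" using step by blast
      from step_users_iff_used[OF this 1(5,6)] i' show ?thesis by (simp add: active_def)
    next
      case 2
      then show ?thesis using unused_step by simp
    qed
  next
    fix j assume j: "j \<in> step_resources M n"
    then have jr: "j \<in> resources M" using step_resources_sub by blast
    show "j \<in> \<Union> (snd ` clusters_at M n y ?r)"
    proof (cases "users_on M y {j} = {}")
      case True
      then have "?r = \<infinity>" using unused_step j jr by simp
      then have "({}, {j}) \<in> clusters_at M n y ?r" using True jr by (auto simp: clusters_at_def)
      then show ?thesis by force
    next
      case False
      then obtain i where i: "i \<in> users M" "j \<in> route M i" "0 < y i j"
        by (auto simp: users_on_def)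
      then have "i \<in> active n (step_users M n)"
        using step_users_iff_used[OF i] j pos_imp_active[OF i] by (simp add: active_def)
      from step[OF this] have "component M y i \<in> clusters_at M n y ?r"
        by (auto simp: clusters_at_def active_def)
      moreover have "j \<in> snd (component M y i)"
        using i by (auto simp: component_def resources_of_def)
      ultimately show ?thesis by blast
    qed
  qed
qed

lemma users_reduced: "users (reduced M n) = users M - step_users M n"
  and resources_reduced: "resources (reduced M n) = resources M - step_resources M n"
  and route_reduced: "route (reduced M n) i = route M i - step_resources M n"
  and capacity_reduced: "capacity (reduced M n) = capacity M"
  by (auto simp: reduced_def)

lemma reduced_zero:
  assumes "i \<in> users (reduced M n)" "j \<in> route M i" "j \<in> step_resources M n"
  shows "y i j = 0"
proof -
  have "i \<in> users M" "i \<notin> step_users M n" using assms(1) by (auto simp: users_reduced)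
  then show ?thesis using step_users_iff_used[of i j] nonneg[of i j] assms by force
qed

lemma rate_reduced:
  assumes "i \<in> users (reduced M n)" shows "rate (reduced M n) y i = rate M y i"
proof -
  have "i \<in> users M" using assms by (auto simp: users_reduced)
  then show ?thesis
    unfolding rate_def route_reduced
    using reduced_zero assms finite_route by (intro sum.mono_neutral_left) auto
qed

lemma load_reduced:
  assumes "j \<in> resources (reduced M n)" shows "load (reduced M n) n y j = load M n y j"
proof -
  have "{i \<in> users (reduced M n). j \<in> route (reduced M n) i} = {i \<in> users M. j \<in> route M i}"
    using assms
    by (auto simp: users_reduced route_reduced resources_reduced step_users_def users_within_def)
  then show ?thesis by (simp add: load_def)
qed

text \<open>Rates and loads of what survives are unchanged, and a user whose route is exhausted by
  the step is removed with it, so routes stay nonempty. Recurrence is phrased through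
  \<open>shift\<close> instead of maximality for this purpose: the reduced network has no new
  arrows, hence no new cycles.\<close>

lemma fair_reduced: "recurrent_fair (reduced M n) n y"
proof
  have users: "i \<in> users M" if "i \<in> users (reduced M n)" for i
    using that by (simp add: users_reduced)
  have route: "route (reduced M n) i \<subseteq> route M i" for i by (auto simp: route_reduced)
  have route_res: "route (reduced M n) i \<subseteq> resources (reduced M n)"
    if "i \<in> users (reduced M n)" for i
    using that route_sub by (auto simp: users_reduced route_reduced resources_reduced)
  show "wf_network (reduced M n)"
    using wf route_res
    by (auto simp: wf_network_def users_reduced resources_reduced route_reduced capacity_reduced
        step_users_def users_within_def)
  show "0 \<le> n i" if "i \<in> users (reduced M n)" for i using that users n_nonneg by blast
  show "feasible (reduced M n) n y"
    unfolding feasible_def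
  proof (intro conjI ballI impI)
    fix j assume j: "j \<in> resources (reduced M n)"
    then have "load (reduced M n) n y j \<le> capacity M j"
      using load_le load_reduced by (simp add: resources_reduced)
    then show "(\<Sum>i | i \<in> users (reduced M n) \<and> j \<in> route (reduced M n) i. n i * y i j)
        \<le> capacity (reduced M n) j"
      by (simp add: load_def capacity_reduced)
  next
    fix i j assume "i \<in> users (reduced M n)" "j \<in> route (reduced M n) i"
    then show "0 \<le> y i j" using users route nonneg by blast
  next
    fix i assume i: "i \<in> users (reduced M n)" "n i = 0"
    then show "rate (reduced M n) y i = 0"
      using feasible users by (auto simp: rate_reduced feasible_def)
  qed
  show "0 < rate (reduced M n) y i" if "i \<in> users (reduced M n)" "0 < n i" for i
    using that rate_pos users by (simp add: rate_reduced)
  show "load (reduced M n) n y j = capacity (reduced M n) j"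
    if "i \<in> users (reduced M n)" "0 < n i" "j \<in> route (reduced M n) i" for i j
  proof -
    have "j \<in> resources (reduced M n)" "j \<in> route M i" using that route route_res by blast+
    then show ?thesis
      using that saturated[of i j] users by (simp add: load_reduced capacity_reduced)
  qed
  show "rate (reduced M n) y i' \<le> rate (reduced M n) y i"
    if "i \<in> users (reduced M n)" "0 < n i" "i' \<in> users (reduced M n)" "j \<in> route (reduced M n) i"
      "j \<in> route (reduced M n) i'" "0 < y i' j" for i i' j
    using that rate_le[of i i' j] users route by (auto simp: rate_reduced)
  have "shift (reduced M n) y \<subseteq> shift M y"
    using users route unfolding shift_def by blast
  then have "(shift (reduced M n) y)\<^sup>* \<subseteq> (shift M y)\<^sup>*" by (rule rtrancl_mono)
  then show "0 < y i j'"
    if "i \<in> users (reduced M n)" "j \<in> route (reduced M n) i" "0 < y i j"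
      "j' \<in> route (reduced M n) i" "(j', j) \<in> (shift (reduced M n) y)\<^sup>*" for i j j'
    using that recurrent[of i j j'] users route by blast
qed

text \<open>A link goes through a resource from which both users draw, so it cannot join a surviving
  user to a removed one.\<close>

lemma component_reduced:
  assumes "i \<in> users (reduced M n)"
  shows "component (reduced M n) y i = component M y i"
proof -
  have link: "(k, l) \<in> link (reduced M n) y \<and> l \<in> users (reduced M n)"
    if kl: "(k, l) \<in> link M y" "k \<in> users (reduced M n)" for k l
  proof -
    obtain j where j: "k \<in> users M" "l \<in> users M" "j \<in> route M k" "j \<in> route M l"
        "0 < y k j" "0 < y l j"
      using kl(1) by (auto simp: link_def)
    then have "j \<notin> step_resources M n" "l \<notin> step_users M n"
      using step_users_iff_used kl(2) by (auto simp: users_reduced)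
    then show ?thesis using j kl by (auto simp: link_def users_reduced route_reduced)
  qed
  have sub: "link (reduced M n) y \<subseteq> link M y"
    by (auto simp: link_def users_reduced route_reduced)
  have "(i, k) \<in> (link (reduced M n) y)\<^sup>* \<and> k \<in> users (reduced M n)"
    if "(i, k) \<in> (link M y)\<^sup>*" for k
    using that
  proof (induction rule: rtrancl_induct)
    case (step k l)
    then show ?case using link[of k l] by (auto intro: rtrancl_into_rtrancl)
  qed (use assms in auto)
  then have img: "(link (reduced M n) y)\<^sup>* `` {i} = (link M y)\<^sup>* `` {i}"
    and img_users: "(link M y)\<^sup>* `` {i} \<subseteq> users (reduced M n)"
    using rtrancl_mono[OF sub] by auto
  have "resources_of (reduced M n) y ((link M y)\<^sup>* `` {i}) =
      resources_of M y ((link M y)\<^sup>* `` {i})"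
    using img_users reduced_zero by (force simp: resources_of_def route_reduced)
  then show ?thesis by (simp add: component_def img)
qed

lemma clusters_at_reduced:
  "clusters_at (reduced M n) n y s = (if s = min_ratio M n then {} else clusters_at M n y s)"
proof -
  let ?r = "min_ratio M n"
  have "{i \<in> active n (users (reduced M n)). ereal (rate (reduced M n) y i) = s} =
      {i \<in> active n (users M). ereal (rate M y i) = s \<and> s \<noteq> ?r}"
    using step_users_iff_rate(1) by (auto simp: active_def rate_reduced) (auto simp: users_reduced rate_reduced)
  moreover have "component (reduced M n) y i = component M y i"
    if "i \<in> active n (users M)" "ereal (rate M y i) \<noteq> ?r" for i
    using that step_users_iff_rate(1)[of i]
    by (intro component_reduced) (auto simp: active_def users_reduced)
  ultimately have c: "component (reduced M n) y `
      {i \<in> active n (users (reduced M n)). ereal (rate (reduced M n) y i) = s} =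
    component M y ` {i \<in> active n (users M). ereal (rate M y i) = s \<and> s \<noteq> ?r}"
    by (auto intro!: image_cong)
  have "users_on (reduced M n) y {j} = users_on M y {j}" if "j \<in> resources (reduced M n)" for j
    using that step_users_iff_used
    by (auto simp: users_on_def users_reduced route_reduced resources_reduced)
  then have "{j. s = \<infinity> \<and> j \<in> resources (reduced M n) \<and> users_on (reduced M n) y {j} = {}} =
      {j. s = \<infinity> \<and> j \<in> resources M \<and> users_on M y {j} = {} \<and> s \<noteq> ?r}"
    using unused_step by (auto simp: resources_reduced)
  then have "{({} :: 'i set, {j}) |j. s = \<infinity> \<and> j \<in> resources (reduced M n) \<and>
        users_on (reduced M n) y {j} = {}} =
      {({}, {j}) |j. s = \<infinity> \<and> j \<in> resources M \<and> users_on M y {j} = {} \<and> s \<noteq> ?r}"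
    by blast
  with c show ?thesis by (auto simp: clusters_at_def)
qed

lemma levels_eq:
  "levels M n y = (\<lambda>i. ereal (rate M y i)) ` active n (users M) \<union>
     (if \<exists>j\<in>resources M. users_on M y {j} = {} then {\<infinity>} else {})"
  by (auto simp: levels_def clusters_at_def)

lemma finite_levels: "finite (levels M n y)"
  by (simp add: levels_eq active_def)

lemma levels_empty: "levels M n y = {} \<longleftrightarrow> resources M = {}"
proof
  assume "resources M = {}"
  then show "levels M n y = {}"
    using route_sub route_nonempty by (auto simp: levels_eq active_def)
next
  assume *: "levels M n y = {}"
  have "False" if "j \<in> resources M" for j
  proof -
    have "users_on M y {j} \<noteq> {}" "active n (users M) = {}"
      using * that by (auto simp: levels_eq split: if_splits)
    then show ?thesis using pos_imp_active by (auto simp: users_on_def active_def)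
  qed
  then show "resources M = {}" by blast
qed

lemma Min_levels:
  assumes "resources M \<noteq> {}" shows "Min (levels M n y) = min_ratio M n"
proof (rule Min_eqI[OF finite_levels])
  show "min_ratio M n \<le> s" if "s \<in> levels M n y" for s
    using that step_users_iff_rate(2) by (auto simp: levels_eq active_def split: if_splits)
  show "min_ratio M n \<in> levels M n y"
    using assms
  proof (cases rule: step_cases)
    case (low \<rho>)
    interpret fair_lowest M n y \<rho> by fact
    show ?thesis using rho_attained by (auto simp: levels_eq active_def min_ratio_eq)
  next
    case idle
    then have "users_on M y {j} = {}" for j
      using pos_imp_active by (auto simp: active_def users_on_def)
    then show ?thesis using assms no_active[OF idle assms] by (auto simp: levels_eq)
  qed
qed

lemma levels_reduced:
  "levels (reduced M n) n y = levels M n y - {min_ratio M n}"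
  by (auto simp: levels_def clusters_at_reduced)

lemma sorted_levels:
  assumes "resources M \<noteq> {}"
  shows "sorted_list_of_set (levels M n y) =
    min_ratio M n # sorted_list_of_set (levels (reduced M n) n y)"
  using sorted_list_of_set_nonempty[OF finite_levels] assms
  by (simp add: levels_empty Min_levels levels_reduced)

end

section \<open>Iterating the steps\<close>

context recurrent_fair
begin

lemma residual_fair: "recurrent_fair (residual M n k) n y"
  by (induction k) (auto intro: recurrent_fair.fair_reduced recurrent_fair_axioms)

lemma residual_users_sub: "users (residual M n k) \<subseteq> users M"
  by (induction k) (auto simp: reduced_def)

lemma residual_rate: "i \<in> users (residual M n k) \<Longrightarrow> rate (residual M n k) y i = rate M y i"
proof (induction k)
  case (Suc k)
  interpret R: recurrent_fair "residual M n k" n y by (rule residual_fair)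
  have "i \<in> users (residual M n k)" using Suc.prems R.users_reduced by simp
  then show ?case using Suc R.rate_reduced by simp
qed simp

abbreviation "level_list \<equiv> sorted_list_of_set (levels M n y)"

text \<open>Each step takes the head off the sorted list of levels. The claim about clusters is
  restricted to surviving levels because those of the removed levels are gone from the residual
  network.\<close>

lemma residual_levels:
  "k \<le> card (levels M n y) \<Longrightarrow>
    sorted_list_of_set (levels (residual M n k) n y) = drop k level_list \<and>
    (\<forall>s\<in>levels (residual M n k) n y. clusters_at (residual M n k) n y s = clusters_at M n y s)"
proof (induction k)
  case (Suc k)
  interpret R: recurrent_fair "residual M n k" n y by (rule residual_fair)
  have IH: "sorted_list_of_set (levels (residual M n k) n y) = drop k level_list"
    "\<forall>s\<in>levels (residual M n k) n y. clusters_at (residual M n k) n y s = clusters_at M n y s"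
    using Suc by auto
  have "drop k level_list \<noteq> []" using Suc.prems by simp
  then have "levels (residual M n k) n y \<noteq> {}" using IH(1) by force
  then have "resources (residual M n k) \<noteq> {}" using R.levels_empty by blast
  from R.sorted_levels[OF this] have
    "drop k level_list = min_ratio (residual M n k) n #
      sorted_list_of_set (levels (residual M n (Suc k)) n y)"
    using IH(1) by simp
  then have "drop (Suc k) level_list = sorted_list_of_set (levels (residual M n (Suc k)) n y)"
    by (metis drop_Suc list.sel(3) tl_drop)
  moreover have "clusters_at (residual M n (Suc k)) n y s = clusters_at M n y s"
    if "s \<in> levels (residual M n (Suc k)) n y" for s
    using that IH(2) R.levels_reduced R.clusters_at_reduced by auto
  ultimately show ?case by simp
qed simp

lemma residual_step:
  assumes "k < card (levels M n y)"
  shows "resources (residual M n k) \<noteq> {}"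
    and "min_ratio (residual M n k) n = level_list ! k"
    and "clusters_at (residual M n k) n y (min_ratio (residual M n k) n) =
      clusters_at M n y (level_list ! k)"
proof -
  interpret R: recurrent_fair "residual M n k" n y by (rule residual_fair)
  note L = residual_levels[OF less_imp_le[OF assms]]
  have ne: "drop k level_list \<noteq> []" using assms by simp
  then have "levels (residual M n k) n y \<noteq> {}" using L by force
  then show res: "resources (residual M n k) \<noteq> {}" using R.levels_empty by blast
  have "drop k level_list = level_list ! k # drop (Suc k) level_list"
    using assms by (simp add: Cons_nth_drop_Suc)
  then show min: "min_ratio (residual M n k) n = level_list ! k"
    using R.sorted_levels[OF res] L by simp
  have "min_ratio (residual M n k) n \<in> levels (residual M n k) n y"
    using R.Min_levels[OF res] Min_in[OF R.finite_levels] R.levels_empty res by metis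
  then show "clusters_at (residual M n k) n y (min_ratio (residual M n k) n) =
      clusters_at M n y (level_list ! k)"
    using L min by auto
qed

text \<open>Every resource contributes to some level, be it the infinite one, so exhausted levels
  leave no resources. A remaining user would need a nonempty route.\<close>

lemma residual_end:
  "resources (residual M n (card (levels M n y))) = {}"
  "users (residual M n (card (levels M n y))) = {}"
proof -
  let ?k = "card (levels M n y)"
  interpret R: recurrent_fair "residual M n ?k" n y by (rule residual_fair)
  have "sorted_list_of_set (levels (residual M n ?k) n y) = []"
    using residual_levels[of ?k] by simp
  then have "levels (residual M n ?k) n y = {}" using R.finite_levels by simp
  then show res: "resources (residual M n ?k) = {}" using R.levels_empty by blast
  then show "users (residual M n ?k) = {}" using R.route_sub R.route_nonempty by blast
qed

end

lemma users_within_reduced: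
  assumes "J' \<subseteq> resources (reduced M n)"
  shows "users_within (reduced M n) J' =
    users_within M (J' \<union> step_resources M n) - users_within M (step_resources M n)"
  using assms by (auto simp: users_within_def reduced_def step_users_def)

lemma disjoint_own:
  assumes "disjoint (minimizers M n)" "S \<in> minimizers M n"
  shows "own_resources M n S = S" "own_users M n S = users_within M S" "S \<noteq> {}"
proof -
  show "S \<noteq> {}" using assms(2) by (auto simp: minimizers_def strongly_connected_def)
  have "smaller_minimizers M n S = {}"
  proof (rule ccontr)
    assume "smaller_minimizers M n S \<noteq> {}"
    then obtain T where "T \<in> minimizers M n" "T \<subset> S" by (auto simp: smaller_minimizers_def)
    moreover from this have "T \<inter> S = {}" using assms by (metis disjointD psubset_eq)
    moreover have "T \<noteq> {}"
      using calculation(1) by (auto simp: minimizers_def strongly_connected_def)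
    ultimately show False by blast
  qed
  then show "own_resources M n S = S" "own_users M n S = users_within M S"
    by (auto simp: own_resources_def own_users_def)
qed

section \<open>Existence of a recurrent fair allocation\<close>

context flow_network
begin

lemma rate_add: "rate N (\<lambda>i j. y i j + e * c i j) i = rate N y i + e * rate N c i"
  by (simp add: rate_def sum.distrib sum_distrib_left)

lemma load_add: "load N n (\<lambda>i j. y i j + e * c i j) j = load N n y j + e * load N n c j"
  by (simp add: load_def sum.distrib sum_distrib_left algebra_simps)

text \<open>The feasible directions at \<open>y\<close> in the sense of optimization: constraints
  holding with equality must not be worsened, while all others tolerate a small step.\<close>

definition direction :: "('i \<Rightarrow> 'j \<Rightarrow> real) \<Rightarrow> ('i \<Rightarrow> 'j \<Rightarrow> real) \<Rightarrow> bool" where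
  "direction y c \<longleftrightarrow>
     (\<forall>i\<in>users N. \<forall>j\<in>route N i. c i j < 0 \<longrightarrow> 0 < y i j) \<and>
     (\<forall>j\<in>resources N. 0 < load N n c j \<longrightarrow> load N n y j < capacity N j) \<and>
     (\<forall>i\<in>users N. n i = 0 \<longrightarrow> (\<forall>j\<in>route N i. c i j = 0))"

lemma eventually_feasible:
  assumes y: "feasible N n y" and c: "direction y c"
  shows "\<forall>\<^sub>F e in at_right 0. feasible N n (\<lambda>i j. y i j + e * c i j)"
proof -
  have lim: "((\<lambda>e. a + e * b) \<longlongrightarrow> a) (at_right 0)" for a b :: real
    by (auto intro!: tendsto_eq_intros)
  have "\<forall>\<^sub>F e in at_right 0. load N n y j + e * load N n c j \<le> capacity N j"
    if "j \<in> resources N" for j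
  proof (cases "0 < load N n c j")
    case True
    then have "load N n y j < capacity N j" using c that by (auto simp: direction_def)
    from order_tendstoD(2)[OF lim[of _ "load N n c j"] this] show ?thesis by eventually_elim simp
  next
    case False
    have le: "load N n y j \<le> capacity N j" using y that by (auto simp: feasible_iff)
    from eventually_at_right_less[of "0::real"] show ?thesis
    proof eventually_elim
      case (elim e)
      then have "e * load N n c j \<le> 0" using False by (simp add: mult_le_0_iff)
      then show ?case using le by simp
    qed
  qed
  moreover have "\<forall>\<^sub>F e in at_right 0. 0 \<le> y i j + e * c i j"
    if "i \<in> users N" "j \<in> route N i" for i j
  proof (cases "c i j < 0")
    case True
    then have "0 < y i j" using c that by (auto simp: direction_def)
    from order_tendstoD(1)[OF lim[of _ "c i j"] this] show ?thesis by eventually_elim simp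
  next
    case False
    have "0 \<le> y i j" using y that by (auto simp: feasible_iff)
    with False show ?thesis
      by (intro eventually_mono[OF eventually_at_right_less]) simp
  qed
  ultimately have
    "\<forall>\<^sub>F e in at_right 0. (\<forall>j\<in>resources N. load N n y j + e * load N n c j \<le> capacity N j) \<and>
      (\<forall>i\<in>users N. \<forall>j\<in>route N i. 0 \<le> y i j + e * c i j)"
    using finite_route by (intro eventually_conj eventually_ball_finite ballI) auto
  then show ?thesis
    by eventually_elim (use y c in \<open>auto simp: feasible_iff load_add direction_def\<close>)
qed

text \<open>Below \<open>rate_bound\<close>, minus the quadratic cost is increasing in every rate, like a utility.\<close>

definition rate_bound :: real where
  "rate_bound = 1 + (\<Sum>i | i \<in> users N \<and> 0 < n i. sum (capacity N) (resources N) / n i)"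

lemma rate_less_bound:
  assumes y: "feasible N n y" and i: "i \<in> users N" "0 < n i"
  shows "rate N y i < rate_bound"
proof -
  have cap0: "0 \<le> capacity N j" if "j \<in> resources N" for j
    using capacity_pos that by (simp add: less_imp_le)
  have nn: "0 \<le> n k * y k j" if "k \<in> users N" "j \<in> route N k" for k j
    using y n_nonneg that by (simp add: feasible_iff)
  have "n i * y i j \<le> capacity N j" if j: "j \<in> route N i" for j
  proof -
    have "n i * y i j \<le> load N n y j"
      unfolding load_def using i(1) j nn by (intro member_le_sum) auto
    also have "\<dots> \<le> capacity N j" using y route_sub i(1) j by (auto simp: feasible_iff)
    finally show ?thesis .
  qed
  then have "n i * rate N y i \<le> sum (capacity N) (route N i)"
    unfolding rate_def sum_distrib_left by (rule sum_mono)
  also have "\<dots> \<le> sum (capacity N) (resources N)"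
    using route_sub[OF i(1)] cap0 by (intro sum_mono2) auto
  finally have "rate N y i \<le> sum (capacity N) (resources N) / n i"
    using i by (simp add: field_simps)
  also have "\<dots> \<le> (\<Sum>i | i \<in> users N \<and> 0 < n i. sum (capacity N) (resources N) / n i)"
    using i cap0 by (intro member_le_sum[of i _ "\<lambda>i. sum (capacity N) (resources N) / n i"])
      (auto intro!: divide_nonneg_nonneg sum_nonneg)
  \<comment> \<open>The summand \<open>1\<close> of \<open>rate_bound\<close> makes the estimate
    strict.\<close>
  finally show ?thesis by (simp add: rate_bound_def)
qed

definition cost :: "('i \<Rightarrow> 'j \<Rightarrow> real) \<Rightarrow> real" where
  "cost y = (\<Sum>i\<in>users N. n i * (rate N y i - rate_bound)\<^sup>2)"

definition minimizer :: "('i \<Rightarrow> 'j \<Rightarrow> real) \<Rightarrow> bool" where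
  "minimizer y \<longleftrightarrow> feasible N n y \<and> (\<forall>z. feasible N n z \<longrightarrow> cost y \<le> cost z)"

text \<open>The first-order condition at a minimizer. The change of the cost along \<open>c\<close>
  is divided by the step \<open>e\<close>; for \<open>e\<close> tending to \<open>0\<close> only the
  linear coefficient is left, which is twice the stated sum.\<close>

lemma variation:
  assumes y: "minimizer y" and c: "direction y c"
  shows "0 \<le> (\<Sum>i\<in>users N. n i * (rate N y i - rate_bound) * rate N c i)"
proof -
  let ?a = "\<Sum>i\<in>users N. n i * (rate N y i - rate_bound) * rate N c i"
  let ?b = "\<Sum>i\<in>users N. n i * (rate N c i)\<^sup>2"
  have cost: "cost (\<lambda>i j. y i j + e * c i j) = cost y + e * (2 * ?a + e * ?b)" for e
  proof -
    have "cost (\<lambda>i j. y i j + e * c i j) = (\<Sum>i\<in>users N. n i * (rate N y i - rate_bound)\<^sup>2 +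
        e * (2 * (n i * (rate N y i - rate_bound) * rate N c i) + e * (n i * (rate N c i)\<^sup>2)))"
      unfolding cost_def rate_add
      by (intro sum.cong refl) (simp add: power2_eq_square algebra_simps)
    then show ?thesis by (simp only: cost_def sum.distrib flip: sum_distrib_left)
  qed
  have "\<forall>\<^sub>F e in at_right 0. feasible N n (\<lambda>i j. y i j + e * c i j)"
    using eventually_feasible y c by (simp add: minimizer_def)
  with eventually_at_right_less[of "0::real"] have "\<forall>\<^sub>F e in at_right 0. 0 \<le> 2 * ?a + e * ?b"
  proof eventually_elim
    case (elim e)
    then have "cost y \<le> cost (\<lambda>i j. y i j + e * c i j)" using y by (simp add: minimizer_def)
    then show ?case using elim(1) by (simp add: cost zero_le_mult_iff)
  qed
  moreover have "((\<lambda>e. 2 * ?a + e * ?b) \<longlongrightarrow> 2 * ?a) (at_right 0)"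
    by (auto intro!: tendsto_eq_intros)
  ultimately have "0 \<le> 2 * ?a"
    by (intro tendsto_lowerbound[of "\<lambda>e. 2 * ?a + e * ?b" _ "at_right 0"]) auto
  then show ?thesis by simp
qed

text \<open>The factor \<open>1 / n i\<close> makes this displacement raise the load of
  \<open>j\<close> by exactly one. It also cancels the weight \<open>n i\<close> in
  \<open>variation\<close>, so that the rates of different users can be compared directly.\<close>

definition unit :: "'i \<Rightarrow> 'j \<Rightarrow> 'i \<Rightarrow> 'j \<Rightarrow> real" where
  "unit i j i' j' = (if i' = i \<and> j' = j then 1 / n i else 0)"

lemma rate_unit:
  assumes "i \<in> users N" "j \<in> route N i"
  shows "rate N (unit i j) i' = (if i' = i then 1 / n i else 0)"
  using assms finite_route by (auto simp: rate_def unit_def)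

lemma load_unit:
  assumes "i \<in> users N" "j \<in> route N i" "0 < n i"
  shows "load N n (unit i j) j' = of_bool (j' = j)"
proof -
  have "load N n (unit i j) j' =
      (\<Sum>k | k \<in> users N \<and> j' \<in> route N k. if k = i then of_bool (j' = j) else 0)"
    unfolding load_def using assms(3) by (intro sum.cong) (auto simp: unit_def)
  then show ?thesis using assms by auto
qed

lemma minimizer_fair:
  assumes y: "minimizer y" shows "fair N n y"
proof -
  have feas: "feasible N n y" using y by (simp add: minimizer_def)
  have sat: "load N n y j = capacity N j"
    if i: "i \<in> users N" "0 < n i" "j \<in> route N i" for i j
  proof (rule ccontr)
    assume "load N n y j \<noteq> capacity N j"
    moreover have "load N n y j \<le> capacity N j"
      using feas route_sub i by (auto simp: feasible_iff)
    \<comment> \<open>Spare capacity could be given to \<open>i\<close>. Since the rate of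
      \<open>i\<close> is below \<open>rate_bound\<close>, this would lower the cost to first
      order.\<close>
    ultimately have "direction y (unit i j)"
      using i by (auto simp: direction_def load_unit) (auto simp: unit_def split: if_splits)
    from variation[OF y this] have
      "0 \<le> (\<Sum>k\<in>users N. if k = i then rate N y i - rate_bound else 0)"
      using i by (simp add: rate_unit if_distrib cong: if_cong sum.cong)
    then show False using rate_less_bound[OF feas i(1,2)] i by simp
  qed
  have le: "rate N y i' \<le> rate N y i"
    if "i \<in> users N" "0 < n i" "i' \<in> users N" "j \<in> route N i" "j \<in> route N i'" "0 < y i' j"
    for i i' j
  proof (cases "i' = i")
    case False
    \<comment> \<open>One unit of load on \<open>j\<close> passes from \<open>i'\<close> to
      \<open>i\<close>. All loads stay the same, and the linear coefficient is
      \<open>rate N y i - rate N y i'\<close>.\<close>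
    let ?c = "\<lambda>k l. unit i j k l + (-1) * unit i' j k l"
    have n': "0 < n i'" using active_if_pos feas that by blast
    have "direction y ?c"
      unfolding direction_def load_add
      using that n' by (auto simp: load_unit) (auto simp: unit_def split: if_splits)
    from variation[OF y this] have
      "0 \<le> (\<Sum>k\<in>users N. n k * (rate N y k - rate_bound) * (rate N (unit i j) k - rate N (unit i' j) k))"
      unfolding rate_add by simp
    also have "\<dots> = (\<Sum>k\<in>users N. (if k = i then rate N y i - rate_bound else 0) -
        (if k = i' then rate N y i' - rate_bound else 0))"
      using that n' False by (intro sum.cong) (auto simp: rate_unit)
    also have "\<dots> = rate N y i - rate N y i'"
      using that by (simp add: sum_subtractf)
    finally show ?thesis by simp
  qed simp
  have pos: "0 < rate N y i" if i: "i \<in> users N" "0 < n i" for i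
  proof -
    obtain j where j: "j \<in> route N i" using route_nonempty i by blast
    \<comment> \<open>A saturated resource serves somebody, whose rate is positive and, by
      \<open>le\<close>, at most that of \<open>i\<close>.\<close>
    have "0 < load N n y j" using sat[OF i j] capacity_pos route_sub i j by auto
    then obtain i' where i': "i' \<in> users N" "j \<in> route N i'" "0 < n i' * y i' j"
      unfolding load_def by (metis (mono_tags, lifting) linorder_not_le mem_Collect_eq sum_nonpos)
    then have "0 < y i' j" using n_nonneg[OF i'(1)] by (simp add: zero_less_mult_iff)
    moreover have "y i' j \<le> rate N y i'"
      unfolding rate_def using i' feas finite_route
      by (intro member_le_sum) (auto simp: feasible_iff)
    ultimately show ?thesis using le[OF i i'(1) j i'(2)] by linarith
  qed
  show ?thesis using feas sat le pos by unfold_locales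
qed

lemma exists_minimizer: "\<exists>y. minimizer y"
proof -
  \<comment> \<open>The product ranges over the whole index types, so coordinates outside the
    network or of users without flows are frozen at \<open>0\<close> to keep it compact. On the
    others, capacity alone bounds \<open>y i j\<close> by \<open>capacity N j / n i\<close>.\<close>
  define K where "K i j = (if i \<in> users N \<and> j \<in> route N i \<and> 0 < n i
    then {0..capacity N j / n i} else {0})" for i j
  define F where "F = {y \<in> PiE UNIV (\<lambda>i. PiE UNIV (K i)). \<forall>j\<in>resources N. load N n y j \<le> capacity N j}"
  have K: "compact (K i j)" for i j by (simp add: K_def)
  \<comment> \<open>Allocations are curried, so Tychonoff's theorem is applied twice: over the
    resources, then over the users.\<close>
  have "compactin (product_topology (\<lambda>_. euclidean) UNIV) (PiE UNIV (K i))" for i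
    using K by (simp add: compactin_PiE)
  then have "compact (PiE UNIV (K i))" for i
    by (simp add: euclidean_product_topology)
  then have "compactin (product_topology (\<lambda>_. euclidean) UNIV) (PiE UNIV (\<lambda>i. PiE UNIV (K i)))"
    by (simp add: compactin_PiE)
  then have comp: "compact (PiE UNIV (\<lambda>i. PiE UNIV (K i)))"
    by (simp add: euclidean_product_topology)
  have cont: "continuous_on UNIV (\<lambda>y :: 'i \<Rightarrow> 'j \<Rightarrow> real. y i j)" for i j
    by (rule continuous_on_product_then_coordinatewise[OF continuous_on_product_coordinates])
  have "continuous_on UNIV (\<lambda>y. load N n y j)" for j
    unfolding load_def by (intro continuous_intros cont)
  then have "closed {y. load N n y j \<le> capacity N j}" for j
    by (intro closed_Collect_le continuous_on_const)
  then have "closed (\<Inter>j\<in>resources N. {y. load N n y j \<le> capacity N j})" by blast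
  moreover have "F = PiE UNIV (\<lambda>i. PiE UNIV (K i)) \<inter> (\<Inter>j\<in>resources N. {y. load N n y j \<le> capacity N j})"
    by (auto simp: F_def)
  ultimately have "compact F" using comp by (simp add: compact_Int_closed)
  moreover have "(0::real) \<in> K i j" for i j
  proof -
    have "0 \<le> capacity N j" if "i \<in> users N" "j \<in> route N i"
      using that route_sub capacity_pos by (meson less_imp_le subsetD)
    then show ?thesis by (auto simp: K_def)
  qed
  then have "(\<lambda>i j. 0) \<in> F"
    using capacity_pos by (auto simp: F_def load_def PiE_UNIV_domain less_imp_le)
  moreover have "continuous_on F cost"
    unfolding cost_def rate_def by (intro continuous_intros continuous_on_subset[OF cont]) auto
  ultimately obtain y where y: "y \<in> F" "\<And>z. z \<in> F \<Longrightarrow> cost y \<le> cost z"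
    using continuous_attains_inf[of F cost] by blast
  have yK: "y i j \<in> K i j" for i j using y(1) by (simp add: F_def PiE_UNIV_domain Pi_iff)
  have "feasible N n y"
    unfolding feasible_iff
  proof (intro conjI ballI impI)
    show "load N n y j \<le> capacity N j" if "j \<in> resources N" for j using y(1) that by (simp add: F_def)
    show "0 \<le> y i j" for i j using yK[of i j] by (auto simp: K_def split: if_splits)
    show "y i j = 0" if "n i = 0" for i j using yK[of i j] that by (simp add: K_def)
  qed
  moreover have "cost y \<le> cost z" if z: "feasible N n z" for z
  proof -
    \<comment> \<open>A feasible \<open>z\<close> is arbitrary at coordinates outside the network;
      \<open>w\<close> clears these so as to lie in the compact set, without affecting loads or the
      rates of users.\<close>
    define w where "w i j = (if i \<in> users N \<and> j \<in> route N i then z i j else 0)" for i j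
    have load: "load N n w j = load N n z j" for j
      unfolding load_def by (intro sum.cong) (auto simp: w_def)
    have rate: "rate N w i = rate N z i" if "i \<in> users N" for i
      unfolding rate_def using that by (intro sum.cong) (auto simp: w_def)
    have "w i j \<in> K i j" for i j
    proof (cases "i \<in> users N \<and> j \<in> route N i \<and> 0 < n i")
      case True
      have "n i * z i j \<le> load N n z j"
        unfolding load_def using True z n_nonneg by (intro member_le_sum) (auto simp: feasible_iff)
      also have "\<dots> \<le> capacity N j" using True z route_sub by (auto simp: feasible_iff)
      finally have "z i j \<le> capacity N j / n i" using True by (simp add: field_simps)
      then show ?thesis using True z by (auto simp: K_def w_def feasible_iff)
    next
      case False
      then have "n i = 0" if "i \<in> users N" "j \<in> route N i" using n_nonneg[of i] that by auto
      then have "w i j = 0" using z by (auto simp: w_def feasible_iff)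
      then show ?thesis using False by (auto simp: K_def)
    qed
    then have "w \<in> F" using z by (auto simp: F_def PiE_UNIV_domain load feasible_iff)
    moreover have "cost w = cost z" unfolding cost_def using rate by (intro sum.cong) auto
    ultimately show ?thesis using y(2)[of w] by simp
  qed
  ultimately show ?thesis by (auto simp: minimizer_def)
qed

section \<open>Minimizers of maximal support\<close>

definition support :: "('i \<Rightarrow> 'j \<Rightarrow> real) \<Rightarrow> ('i \<times> 'j) set" where
  "support y = {(i, j). i \<in> users N \<and> j \<in> route N i \<and> 0 < y i j}"

lemma finite_support: "finite (support y)"
  by (rule finite_subset[of _ "users N \<times> resources N"]) (use route_sub in \<open>auto simp: support_def\<close>)

text \<open>The mean is written as a displacement to match \<open>load_add\<close> and \<open>rate_add\<close>.\<close>

lemma minimizer_mean: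
  assumes y: "minimizer y" and z: "minimizer z"
  shows "minimizer (\<lambda>i j. y i j + 1/2 * (z i j + (-1) * y i j))" (is "minimizer ?w")
    and "support (\<lambda>i j. y i j + 1/2 * (z i j + (-1) * y i j)) = support y \<union> support z"
proof -
  have f: "feasible N n y" "feasible N n z" using assms by (auto simp: minimizer_def)
  have "feasible N n ?w"
    unfolding feasible_iff load_add
  proof (intro conjI ballI impI)
    fix j assume "j \<in> resources N"
    then have "load N n y j \<le> capacity N j" "load N n z j \<le> capacity N j"
      using f by (auto simp: feasible_iff)
    then show "load N n y j + 1/2 * (load N n z j + -1 * load N n y j) \<le> capacity N j" by (simp add: field_simps)
  next
    fix i j assume "i \<in> users N" "j \<in> route N i"
    then have "0 \<le> y i j" "0 \<le> z i j" using f by (auto simp: feasible_iff)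
    then show "0 \<le> y i j + 1/2 * (z i j + (-1) * y i j)" by (simp add: field_simps)
  qed (use f in \<open>auto simp: feasible_iff\<close>)
  moreover have "cost ?w \<le> cost y"
  proof -
    have "2 * cost ?w \<le> cost y + cost z"
      unfolding cost_def sum_distrib_left sum.distrib[symmetric]
    proof (rule sum_mono)
      fix i assume i: "i \<in> users N"
      let ?a = "rate N y i - rate_bound" and ?b = "rate N z i - rate_bound"
      have r: "rate N ?w i - rate_bound = (?a + ?b) / 2" unfolding rate_add by (simp add: field_simps)
      have "0 \<le> (?a - ?b)\<^sup>2" by simp
      then have "2 * ((?a + ?b) / 2)\<^sup>2 \<le> ?a\<^sup>2 + ?b\<^sup>2"
        by (simp add: power2_eq_square field_simps)
      then have "n i * (2 * ((?a + ?b) / 2)\<^sup>2) \<le> n i * (?a\<^sup>2 + ?b\<^sup>2)"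
        using n_nonneg[OF i] by (rule mult_left_mono)
      then show "2 * (n i * (rate N ?w i - rate_bound)\<^sup>2) \<le> n i * ?a\<^sup>2 + n i * ?b\<^sup>2"
        unfolding r by (simp add: algebra_simps)
    qed
    moreover have "cost z \<le> cost y" using z f by (simp add: minimizer_def)
    ultimately show ?thesis by simp
  qed
  ultimately show "minimizer ?w" using y by (force simp: minimizer_def)
  have "0 < y i j + 1/2 * (z i j + (-1) * y i j) \<longleftrightarrow> 0 < y i j \<or> 0 < z i j"
    if "i \<in> users N" "j \<in> route N i" for i j
  proof -
    have "0 \<le> y i j" "0 \<le> z i j" using f that by (auto simp: feasible_iff)
    then show ?thesis by (auto simp: field_simps)
  qed
  then show "support ?w = support y \<union> support z" unfolding support_def by blast
qed

text \<open>The mean of two minimizers is a minimizer whose support is the union of theirs, so a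
  support of greatest cardinality contains every other.\<close>

lemma exists_maximal_minimizer:
  "\<exists>y. minimizer y \<and> (\<forall>z. minimizer z \<longrightarrow> support z \<subseteq> support y)"
proof -
  obtain y0 where y0: "minimizer y0" using exists_minimizer by blast
  have "card (support z) < card (users N \<times> resources N) + 1" for z
    using card_mono[of "users N \<times> resources N" "support z"] route_sub
    by (fastforce simp: support_def)
  then obtain y where y: "minimizer y" "\<And>z. minimizer z \<Longrightarrow> card (support z) \<le> card (support y)"
    using ex_has_greatest_nat[of minimizer y0 "\<lambda>z. card (support z)"] y0 by (metis)
  have "support z \<subseteq> support y" if "minimizer z" for z
  proof -
    let ?S = "support y \<union> support z"
    have "card ?S \<le> card (support y)"
      using y(2)[OF minimizer_mean(1)[OF y(1) that]] minimizer_mean(2)[OF y(1) that] by simp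
    then have "support y = ?S" using finite_support by (intro card_seteq) auto
    then show ?thesis by blast
  qed
  then show ?thesis using y(1) by blast
qed

text \<open>An arrow from \<open>k\<close> to \<open>l\<close> is realized by its user moving one
  unit of load from \<open>k\<close> to \<open>l\<close>. Along a path these moves telescope to one
  unit moved from \<open>j\<close> to \<open>j'\<close> with all rates fixed. A component can
  decrease only where an arrow starts, and there \<open>y\<close> is positive.\<close>

lemma shift_direction:
  assumes y: "feasible N n y" and path: "(j, j') \<in> (shift N y)\<^sup>*"
  shows "\<exists>d. (\<forall>i\<in>users N. rate N d i = 0) \<and>
    (\<forall>k. load N n d k = of_bool (k = j') - of_bool (k = j)) \<and>
    (\<forall>i\<in>users N. \<forall>k\<in>route N i. d i k < 0 \<longrightarrow> 0 < y i k) \<and>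
    (\<forall>i\<in>users N. n i = 0 \<longrightarrow> (\<forall>k\<in>route N i. d i k = 0))"
  using path
proof (induction rule: rtrancl_induct)
  case base
  show ?case by (rule exI[of _ "\<lambda>_ _. 0"]) (simp add: rate_def load_def)
next
  case (step k l)
  then obtain d where d: "\<forall>i\<in>users N. rate N d i = 0"
    "\<forall>m. load N n d m = of_bool (m = k) - of_bool (m = j)"
    "\<forall>i\<in>users N. \<forall>m\<in>route N i. d i m < 0 \<longrightarrow> 0 < y i m"
    "\<forall>i\<in>users N. n i = 0 \<longrightarrow> (\<forall>m\<in>route N i. d i m = 0)" by blast
  obtain i where i: "i \<in> users N" "k \<in> route N i" "l \<in> route N i" "0 < y i k"
    using step.hyps(2) by (auto simp: shift_def)
  then have n: "0 < n i" using active_if_pos y by blast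
  let ?d = "\<lambda>h m. (d h m + 1 * unit i l h m) + (-1) * unit i k h m"
  have "0 < y h m" if h: "h \<in> users N" "m \<in> route N h" "?d h m < 0" for h m
  proof (cases "h = i \<and> m = k")
    case False
    then have "unit i k h m = 0" "0 \<le> unit i l h m" using n by (auto simp: unit_def)
    then have "d h m < 0" using h(3) by simp
    then show ?thesis using d(3) h by blast
  qed (use i in simp)
  moreover have "rate N ?d h = 0" if "h \<in> users N" for h
    unfolding rate_add using d(1) that i by (simp add: rate_unit)
  moreover have "load N n ?d m = of_bool (m = l) - of_bool (m = j)" for m
    unfolding load_add using d(2) i n by (simp add: load_unit)
  moreover have "?d h m = 0" if "h \<in> users N" "n h = 0" "m \<in> route N h" for h m
    using d(4) that n by (auto simp: unit_def)
  ultimately show ?case by (intro exI[of _ ?d]) blast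
qed

text \<open>If \<open>y i j'\<close> were \<open>0\<close>, the path from \<open>j'\<close> to
  \<open>j\<close>, closed by \<open>i\<close> moving load from \<open>j\<close> to
  \<open>j'\<close>, would give a circulation that changes neither rates nor loads. A small step
  along it keeps the cost, so it leads to another minimizer; but there the component of
  \<open>i\<close> at \<open>j'\<close> is positive, against maximality.\<close>

lemma maximal_recurrent:
  assumes y: "minimizer y" and max: "\<And>z. minimizer z \<Longrightarrow> support z \<subseteq> support y"
  shows "recurrent_fair N n y"
proof -
  interpret fair N n y by (rule minimizer_fair[OF y])
  show ?thesis
  proof
    fix i j j'
    assume i: "i \<in> users N" "j \<in> route N i" "0 < y i j" "j' \<in> route N i"
      and path: "(j', j) \<in> (shift N y)\<^sup>*"
    show "0 < y i j'"
    proof (rule ccontr)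
      assume "\<not> 0 < y i j'"
      then have 0: "y i j' = 0" using nonneg[OF i(1,4)] by simp
      have n: "0 < n i" using pos_imp_active i by blast
      obtain d where d: "\<forall>i\<in>users N. rate N d i = 0"
        "\<forall>m. load N n d m = of_bool (m = j) - of_bool (m = j')"
        "\<forall>i\<in>users N. \<forall>m\<in>route N i. d i m < 0 \<longrightarrow> 0 < y i m"
        "\<forall>i\<in>users N. n i = 0 \<longrightarrow> (\<forall>m\<in>route N i. d i m = 0)"
        using shift_direction[OF feasible path] by blast
      let ?c = "\<lambda>h m. (d h m + 1 * unit i j' h m) + (-1) * unit i j h m"
      have rate: "rate N ?c h = 0" if "h \<in> users N" for h
        unfolding rate_add using d(1) that i by (simp add: rate_unit)
      have load: "load N n ?c m = 0" for m
        unfolding load_add using d(2) i n by (simp add: load_unit)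
      have "0 < y h m" if h: "h \<in> users N" "m \<in> route N h" "?c h m < 0" for h m
      proof (cases "h = i \<and> m = j")
        case False
        then have "unit i j h m = 0" "0 \<le> unit i j' h m" using n by (auto simp: unit_def)
        then have "d h m < 0" using h(3) by simp
        then show ?thesis using d(3) h by blast
      qed (use i in simp)
      moreover have "?c h m = 0" if "h \<in> users N" "n h = 0" "m \<in> route N h" for h m
        using d(4) that n by (auto simp: unit_def)
      ultimately have "direction y ?c" unfolding direction_def load by auto
      from eventually_feasible[OF feasible this]
      have "\<forall>\<^sub>F e in at_right 0. 0 < e \<and> feasible N n (\<lambda>h m. y h m + e * ?c h m)"
        by (rule eventually_conj[OF eventually_at_right_less])
      then obtain e where e: "0 < e" "feasible N n (\<lambda>h m. y h m + e * ?c h m)"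
        by (metis (no_types, lifting) eventually_happens trivial_limit_at_right_real)
      let ?z = "\<lambda>h m. y h m + e * ?c h m"
      have "rate N ?z h = rate N y h" if "h \<in> users N" for h
        unfolding rate_add[of y e ?c] using rate that by simp
      then have "cost ?z = cost y" unfolding cost_def by simp
      then have "minimizer ?z" using e(2) y by (simp add: minimizer_def)
      then have "support ?z \<subseteq> support y" by (rule max)
      moreover have "j \<noteq> j'" using 0 i by auto
      \<comment> \<open>As \<open>y i j'\<close> is \<open>0\<close>, the entry
        \<open>d i j'\<close> is not negative, so the path cannot cancel what \<open>i\<close> puts
        on \<open>j'\<close>.\<close>
      then have "0 < ?c i j'" using d(3) 0 i n by (force simp: unit_def intro: add_nonneg_pos)
      then have "(i, j') \<in> support ?z" using 0 e(1) i by (simp add: support_def)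
      ultimately show False using 0 by (auto simp: support_def)
    qed
  qed
qed

end

section \<open>Optimality of fair allocations\<close>

lemma utility_concave:
  assumes "utility U" "0 < x" "0 < y" "x \<noteq> y" "0 < t" "t < 1"
  shows "(1 - t) * U x + t * U y < U ((1 - t) * x + t * y)"
  using assms unfolding utility_def by blast

lemma utility_deriv:
  assumes "utility U" "0 < x" shows "(U has_real_derivative deriv U x) (at x)"
proof -
  have "U differentiable (at x within {0<..})"
    using assms by (auto simp: utility_def differentiable_on_def)
  then have "U differentiable (at x)"
    using assms(2) by (simp add: at_within_open[of x "{0<..}"])
  then show ?thesis
    by (metis DERIV_imp_deriv real_differentiable_def)
qed

lemma utility_tangent_le:
  assumes U: "utility U" and x: "0 < x" and z: "0 < z"
  shows "U z \<le> U x + deriv U x * (z - x)"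
proof -
  have "convex_on {0<..} (\<lambda>x. - U x)"
  proof (rule convex_onI)
    fix t a b :: real assume "0 < t" "t < 1" "a \<in> {0<..}" "b \<in> {0<..}"
    show "- U ((1 - t) *\<^sub>R a + t *\<^sub>R b) \<le> (1 - t) * - U a + t * - U b"
    proof (cases "a = b")
      case True
      have "(1 - t) *\<^sub>R b + t *\<^sub>R b = b" by (simp add: algebra_simps)
      then show ?thesis using True by (simp add: algebra_simps)
    next
      case False
      then have "(1 - t) * U a + t * U b < U ((1 - t) * a + t * b)"
        using \<open>0 < t\<close> \<open>t < 1\<close> \<open>a \<in> {0<..}\<close> \<open>b \<in> {0<..}\<close>
        by (intro utility_concave[OF U]) auto
      then show ?thesis by simp
    qed
  qed simp
  moreover have "((\<lambda>x. - U x) has_real_derivative - deriv U x) (at x within {0<..})"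
    by (rule has_field_derivative_at_within[OF DERIV_minus[OF utility_deriv[OF U x]]])
  ultimately have "- U z - - U x \<ge> - deriv U x * (z - x)"
    using x z by (intro convex_on_imp_above_tangent[of "{0<..}"]) (auto simp: interior_open)
  then show ?thesis by (simp add: algebra_simps)
qed

text \<open>If the tangent at \<open>x\<close> met the graph again at \<open>z\<close>, strict
  concavity would put the graph above the tangent at the midpoint.\<close>

lemma utility_tangent_less:
  assumes U: "utility U" and x: "0 < x" and z: "0 < z" and ne: "z \<noteq> x"
  shows "U z < U x + deriv U x * (z - x)"
proof (rule ccontr)
  assume "\<not> U z < U x + deriv U x * (z - x)"
  then have eq: "U z = U x + deriv U x * (z - x)"
    using utility_tangent_le[OF U x z] by simp
  define m where "m = (1 - 1/2) * x + 1/2 * z"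
  have "(1 - 1/2) * U x + 1/2 * U z < U m"
    unfolding m_def using x z ne by (intro utility_concave[OF U]) auto
  moreover have "U m \<le> U x + deriv U x * (m - x)"
    using x z by (intro utility_tangent_le[OF U]) (auto simp: m_def add_pos_pos)
  ultimately show False by (simp add: eq m_def field_simps)
qed

lemma utility_deriv_antimono:
  assumes U: "utility U" and "0 < x" "x \<le> z" shows "deriv U z \<le> deriv U x"
proof (cases "x = z")
  case False
  have "U z \<le> U x + deriv U x * (z - x)" "U x \<le> U z + deriv U z * (x - z)"
    using assms by (auto intro!: utility_tangent_le)
  then have "(deriv U z - deriv U x) * (z - x) \<le> 0" by (simp add: algebra_simps)
  then show ?thesis using assms False by (simp add: mult_le_0_iff)
qed simp

lemma utility_deriv_nonneg:
  assumes U: "utility U" and x: "0 < x" shows "0 \<le> deriv U x"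
proof -
  have "U x < U (x + 1)"
    using U x by (auto simp: utility_def strict_mono_on_def)
  then show ?thesis using utility_tangent_le[OF U x, of "x + 1"] x by simp
qed

text \<open>Letting the argument tend to \<open>0\<close> in the tangent bound at \<open>x\<close>
  would lose strictness. The limit is therefore taken with the tangent at \<open>x / 2\<close>,
  whose value at \<open>0\<close> is strictly below that of the tangent at \<open>x\<close>.\<close>

lemma utility_at_0:
  assumes U: "utility U" and x: "0 < x"
  shows "utility_at U 0 < ereal (U x + deriv U x * (0 - x))"
proof -
  let ?m = "x / 2"
  have m: "0 < ?m" "?m \<noteq> x" using x by auto
  let ?t = "U ?m + deriv U ?m * (0 - ?m)"
  have "utility_at U 0 \<le> ereal (U ?m + deriv U ?m * (w - ?m))" if "0 < w" for w
  proof -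
    have "utility_at U 0 \<le> ereal (U w)"
      unfolding utility_at_def using that by (auto intro: INF_lower)
    also have "\<dots> \<le> ereal (U ?m + deriv U ?m * (w - ?m))"
      using utility_tangent_le[OF U m(1) that] by simp
    finally show ?thesis .
  qed
  then have ev: "\<forall>\<^sub>F w in at_right 0. utility_at U 0 \<le> ereal (U ?m + deriv U ?m * (w - ?m))"
    using eventually_at_right_less[of "0::real"] by (auto elim: eventually_mono)
  have "((\<lambda>w. ereal (U ?m + deriv U ?m * (w - ?m))) \<longlongrightarrow> ereal ?t) (at_right 0)"
    by (auto intro!: tendsto_eq_intros)
  then have "utility_at U 0 \<le> ereal ?t"
    using ev by (rule tendsto_lowerbound) simp
  moreover have "?t < U x + deriv U x * (0 - x)"
  proof -
    have "U ?m < U x + deriv U x * (?m - x)" by (rule utility_tangent_less[OF U x m])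
    moreover have "deriv U x * ?m \<le> deriv U ?m * ?m"
      using m x by (intro mult_right_mono utility_deriv_antimono[OF U]) auto
    ultimately show ?thesis by (simp add: algebra_simps)
  qed
  ultimately show ?thesis by (meson ereal_less_eq(3) le_less_trans less_ereal.simps(1))
qed

lemma utility_at_less:
  assumes "utility U" "0 < x" "0 \<le> z" "z \<noteq> x"
  shows "utility_at U z < ereal (U x + deriv U x * (z - x))"
  using utility_at_0 utility_tangent_less assms
  by (cases "z = 0") (auto simp: utility_at_def)

section \<open>Optimality through prices\<close>

context fair
begin

text \<open>
  The price \<open>q j\<close> of a resource is the largest marginal utility among the active users that may use
  it. By fairness, this is the marginal utility of those who do use it (complementary slackness).
\<close>

lemma price_inequality:
  assumes U: "utility U" and z: "feasible M n z"
  shows "(\<Sum>i\<in>active n (users M). n i * (deriv U (rate M y i) * (rate M z i - rate M y i))) \<le> 0"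
proof -
  let ?A = "active n (users M)"
  let ?p = "\<lambda>i. deriv U (rate M y i)"
  define q where "q j = Max (?p ` {i \<in> ?A. j \<in> route M i})" for j
  have finA: "finite ?A" by (simp add: active_def)
  have p_le: "?p i \<le> q j" if "i \<in> ?A" "j \<in> route M i" for i j
    unfolding q_def using that finA by (intro Max_ge) auto
  have p_eq: "?p i = q j" if i: "i \<in> ?A" "j \<in> route M i" "0 < y i j" for i j
  proof -
    have "q j \<in> ?p ` {i \<in> ?A. j \<in> route M i}"
      unfolding q_def using i finA by (intro Max_in) auto
    then obtain k where k: "k \<in> ?A" "j \<in> route M k" "q j = ?p k" by auto
    have "rate M y i \<le> rate M y k" using i k by (intro rate_le[of k i j]) (auto simp: active_def)
    then have "?p k \<le> ?p i"
      using i rate_pos by (intro utility_deriv_antimono[OF U]) (auto simp: active_def)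
    then show ?thesis using p_le[OF i(1,2)] k by simp
  qed
  have swap: "(\<Sum>i\<in>?A. n i * (?p i * rate M w i)) =
      (\<Sum>j\<in>resources M. \<Sum>i | i \<in> ?A \<and> j \<in> route M i. n i * (?p i * w i j))" for w
  proof -
    have "(\<Sum>i\<in>?A. n i * (?p i * rate M w i)) =
        (\<Sum>i\<in>?A. \<Sum>j | j \<in> resources M \<and> j \<in> route M i. n i * (?p i * w i j))"
      unfolding rate_def sum_distrib_left
      using route_sub by (intro sum.cong refl) (auto simp: active_def)
    also have "\<dots> = (\<Sum>j\<in>resources M. \<Sum>i | i \<in> ?A \<and> j \<in> route M i. n i * (?p i * w i j))"
      by (rule sum.swap_restrict[OF finA finite_resources])
    finally show ?thesis .
  qed
  have load_eq: "load M n w j = (\<Sum>i | i \<in> ?A \<and> j \<in> route M i. n i * w i j)" for w j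
    unfolding load_def using n_nonneg
    by (intro sum.mono_neutral_right) (auto simp: active_def not_less intro: antisym)
  have z0: "0 \<le> z i j" if "i \<in> users M" "j \<in> route M i" for i j
    using z that by (auto simp: feasible_def)
  \<comment> \<open>On each resource, replacing marginal utilities by the price \<open>q j\<close>
    can only increase the side of \<open>z\<close>. The load of \<open>z\<close> is at most the
    capacity, which \<open>y\<close> attains. On the side of \<open>y\<close>, the price equals the
    marginal utility wherever \<open>y\<close> is positive.\<close>
  have le: "(\<Sum>i | i \<in> ?A \<and> j \<in> route M i. n i * (?p i * z i j)) \<le>
      (\<Sum>i | i \<in> ?A \<and> j \<in> route M i. n i * (?p i * y i j))"
    if j: "j \<in> resources M" for j
  proof (cases "{i \<in> ?A. j \<in> route M i} = {}")
    case False
    then obtain k where k: "k \<in> ?A" "j \<in> route M k" by blast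
    have "0 \<le> ?p k" using k rate_pos by (intro utility_deriv_nonneg[OF U]) (auto simp: active_def)
    then have q0: "0 \<le> q j" using p_le[OF k] by simp
    have "(\<Sum>i | i \<in> ?A \<and> j \<in> route M i. n i * (?p i * z i j)) \<le>
        (\<Sum>i | i \<in> ?A \<and> j \<in> route M i. q j * (n i * z i j))"
    proof (rule sum_mono)
      fix i assume "i \<in> {i. i \<in> ?A \<and> j \<in> route M i}"
      then have "?p i * (n i * z i j) \<le> q j * (n i * z i j)"
        using p_le z0 by (intro mult_right_mono mult_nonneg_nonneg) (auto simp: active_def)
      then show "n i * (?p i * z i j) \<le> q j * (n i * z i j)" by (simp add: algebra_simps)
    qed
    also have "\<dots> = q j * load M n z j" by (simp add: load_eq sum_distrib_left)
    also have "\<dots> \<le> q j * load M n y j"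
    proof (rule mult_left_mono[OF _ q0])
      have "load M n z j \<le> capacity M j" using z j by (auto simp: feasible_def load_def)
      then show "load M n z j \<le> load M n y j"
        using saturated[of k j] k by (simp add: active_def)
    qed
    also have "\<dots> = (\<Sum>i | i \<in> ?A \<and> j \<in> route M i. q j * (n i * y i j))"
      by (simp add: load_eq sum_distrib_left)
    also have "\<dots> = (\<Sum>i | i \<in> ?A \<and> j \<in> route M i. n i * (?p i * y i j))"
    proof (intro sum.cong refl)
      fix i assume i: "i \<in> {i. i \<in> ?A \<and> j \<in> route M i}"
      then have "y i j = 0 \<or> ?p i = q j"
        using p_eq[of i j] nonneg[of i j] by (force simp: active_def)
      then show "q j * (n i * y i j) = n i * (?p i * y i j)" by auto
    qed
    finally show ?thesis .
  next
    case True
    then show ?thesis by (simp only: sum.empty)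
  qed
  have "(\<Sum>i\<in>?A. n i * (?p i * rate M z i)) \<le> (\<Sum>i\<in>?A. n i * (?p i * rate M y i))"
    unfolding swap using le by (rule sum_mono)
  then show ?thesis by (simp add: sum_subtractf algebra_simps)
qed

lemma objective_eq:
  assumes "\<And>i. i \<in> users M \<Longrightarrow> 0 < n i \<Longrightarrow> rate M z i = rate M y i"
  shows "objective M n U z = ereal (\<Sum>i\<in>active n (users M). n i * U (rate M y i))"
proof -
  have "objective M n U z =
      (\<Sum>i\<in>users M. if i \<in> active n (users M) then ereal (n i * U (rate M y i)) else 0)"
    unfolding objective_def
  proof (intro sum.cong refl)
    fix i assume i: "i \<in> users M"
    show "ereal (n i) * utility_at U (rate M z i) =
      (if i \<in> active n (users M) then ereal (n i * U (rate M y i)) else 0)"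
    proof (cases "0 < n i")
      case True
      then show ?thesis using i assms rate_pos by (simp add: active_def utility_at_def)
    next
      case False
      then have "n i = 0" using n_nonneg[OF i] by simp
      then show ?thesis by (simp add: active_def flip: zero_ereal_def)
    qed
  qed
  also have "\<dots> = (\<Sum>i\<in>active n (users M). ereal (n i * U (rate M y i)))"
    by (subst sum.inter_restrict[symmetric]) (auto simp: active_def intro!: sum.cong)
  finally show ?thesis by simp
qed

text \<open>Terms of \<open>z\<close> may be \<open>-\<infinity>\<close>, and in
  \<open>ereal\<close> sums are then not strictly monotone. So each term is replaced by a real upper
  bound \<open>g i\<close> that is still at most the tangent value \<open>t i\<close>, and strictly
  below it where the rates differ. The sum of the tangent values is controlled by
  \<open>price_inequality\<close>.\<close>

lemma objective_less:
  assumes U: "utility U" and z: "feasible M n z"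
    and i0: "i0 \<in> users M" "0 < n i0" "rate M z i0 \<noteq> rate M y i0"
  shows "objective M n U z < objective M n U y"
proof -
  let ?A = "active n (users M)"
  have finA: "finite ?A" by (simp add: active_def)
  define t where "t i = n i * (U (rate M y i) + deriv U (rate M y i) * (rate M z i - rate M y i))"
    for i
  have term_bound: "\<exists>g. ereal (n i) * utility_at U (rate M z i) \<le> ereal g \<and>
      (if rate M z i = rate M y i then g \<le> t i else g < t i)" if i: "i \<in> ?A" for i
  proof (cases "rate M z i = rate M y i")
    case True
    then show ?thesis
      using i rate_pos by (intro exI[of _ "t i"]) (auto simp: t_def utility_at_def active_def)
  next
    case False
    have n: "0 < n i" and iu: "i \<in> users M" using i by (auto simp: active_def)
    have "0 \<le> rate M z i"
      unfolding rate_def using z iu by (intro sum_nonneg) (auto simp: feasible_def)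
    then have "utility_at U (rate M z i) <
        ereal (U (rate M y i) + deriv U (rate M y i) * (rate M z i - rate M y i))"
      using utility_at_less[OF U rate_pos[OF iu n]] False by blast
    then obtain g where g: "utility_at U (rate M z i) < ereal g"
        "g < U (rate M y i) + deriv U (rate M y i) * (rate M z i - rate M y i)"
      using ereal_dense2 by (metis less_ereal.simps(1))
    have "ereal (n i) * utility_at U (rate M z i) \<le> ereal (n i) * ereal g"
      using g(1) n by (intro ereal_mult_left_mono) auto
    then show ?thesis
      using g(2) n False by (intro exI[of _ "n i * g"]) (auto simp: t_def)
  qed
  then obtain g where g: "\<And>i. i \<in> ?A \<Longrightarrow> ereal (n i) * utility_at U (rate M z i) \<le> ereal (g i)"
    "\<And>i. i \<in> ?A \<Longrightarrow> if rate M z i = rate M y i then g i \<le> t i else g i < t i"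
    by metis
  have "objective M n U z = (\<Sum>i\<in>?A. ereal (n i) * utility_at U (rate M z i))"
    unfolding objective_def using n_nonneg
  proof (intro sum.mono_neutral_right ballI)
    fix i assume "i \<in> users M - ?A"
    then have "n i = 0" using n_nonneg[of i] by (auto simp: active_def)
    then show "ereal (n i) * utility_at U (rate M z i) = 0" by (simp flip: zero_ereal_def)
  qed (auto simp: active_def)
  also have "\<dots> \<le> (\<Sum>i\<in>?A. ereal (g i))" using g(1) by (rule sum_mono)
  also have "\<dots> = ereal (sum g ?A)" by simp
  also have "sum g ?A < sum t ?A"
  proof (rule sum_strict_mono_ex1[OF finA])
    show "\<forall>i\<in>?A. g i \<le> t i" using g(2) by (metis less_imp_le)
    show "\<exists>i\<in>?A. g i < t i" using g(2)[of i0] i0 by (auto simp: active_def)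
  qed
  also have "sum t ?A \<le> (\<Sum>i\<in>?A. n i * U (rate M y i))"
    using price_inequality[OF U z] unfolding t_def by (simp add: distrib_left sum.distrib)
  finally show ?thesis unfolding objective_eq[OF refl] by simp
qed

lemma optimal_iff:
  assumes U: "utility U"
  shows "optimal M n U z \<longleftrightarrow> feasible M n z \<and>
    (\<forall>i\<in>users M. 0 < n i \<longrightarrow> rate M z i = rate M y i)"
proof
  assume opt: "optimal M n U z"
  then have z: "feasible M n z" by (simp add: optimal_def)
  have "rate M z i = rate M y i" if "i \<in> users M" "0 < n i" for i
    using objective_less[OF U z that] opt feasible by (force simp: optimal_def)
  then show "feasible M n z \<and> (\<forall>i\<in>users M. 0 < n i \<longrightarrow> rate M z i = rate M y i)"
    using z by blast
next
  assume z: "feasible M n z \<and> (\<forall>i\<in>users M. 0 < n i \<longrightarrow> rate M z i = rate M y i)"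
  have "objective M n U w \<le> objective M n U z" if w: "feasible M n w" for w
  proof -
    have z_eq: "objective M n U z = objective M n U y"
      using z objective_eq[of z] objective_eq[of y] by auto
    show ?thesis
    proof (cases "\<forall>i\<in>users M. 0 < n i \<longrightarrow> rate M w i = rate M y i")
      case True
      then show ?thesis using z_eq objective_eq[of w] objective_eq[of y] by auto
    next
      case False
      then show ?thesis using z_eq objective_less[OF U w] by (auto intro: less_imp_le)
    qed
  qed
  then show "optimal M n U z" using z by (simp add: optimal_def)
qed

end

section \<open>From optimal allocations to clusters\<close>

context flow_network
begin

text \<open>Minimizers are fair and hence optimal. Conversely, an optimal allocation shares the
  rates of users with flows with a minimizer, and \<open>cost\<close> depends on nothing else. In
  particular, all utilities have the same optimal allocations.\<close>

lemma optimal_iff_minimizer: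
  assumes "utility U" shows "optimal N n U z \<longleftrightarrow> minimizer z"
proof -
  obtain y where y: "minimizer y" using exists_minimizer by blast
  have 1: "minimizer z" if "optimal N n U z" for z
  proof -
    have *: "feasible N n z" "\<forall>i\<in>users N. 0 < n i \<longrightarrow> rate N z i = rate N y i"
      using that fair.optimal_iff[OF minimizer_fair[OF y] assms] by auto
    have "cost z = cost y"
      unfolding cost_def
    proof (intro sum.cong refl)
      fix i assume "i \<in> users N"
      then show "n i * (rate N z i - rate_bound)\<^sup>2 = n i * (rate N y i - rate_bound)\<^sup>2"
        using *(2) n_nonneg[of i] by (cases "n i = 0") auto
    qed
    then show ?thesis using *(1) y by (simp add: minimizer_def)
  qed
  have 2: "optimal N n U z" if "minimizer z" for z
    using that fair.optimal_iff[OF minimizer_fair[OF that] assms, of z] by (simp add: minimizer_def)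
  show ?thesis using 1 2 by blast
qed

end

text \<open>By \<open>pos\<close>, a path witnessed by any optimal \<open>z\<close> is also a path
  for \<open>y\<close>. The quantifier over optimal allocations thus collapses to \<open>y\<close>,
  and a cluster is a component of \<open>link N y\<close> containing a user with flows, or a
  resource that nobody uses.\<close>

lemma cluster_with_rate_iff:
  assumes "recurrent_fair N n y" and y: "optimal N n U y"
    and pos: "\<And>z i j. optimal N n U z \<Longrightarrow> i \<in> users N \<Longrightarrow> j \<in> route N i \<Longrightarrow> 0 < z i j \<Longrightarrow> 0 < y i j"
    and rate: "\<And>z i. optimal N n U z \<Longrightarrow> i \<in> users N \<Longrightarrow> 0 < n i \<Longrightarrow> rate N z i = rate N y i"
  shows "cluster_with_rate N n U s I' J' \<longleftrightarrow> (I', J') \<in> clusters_at N n y s"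
proof -
  interpret recurrent_fair N n y by fact
  let ?C = "\<lambda>i. (link N y)\<^sup>* `` {i}"
  have link: "(link N z)\<^sup>* \<subseteq> (link N y)\<^sup>*" if "optimal N n U z" for z
    using pos[OF that] by (intro rtrancl_mono) (auto simp: link_def)
  have users: "{i' \<in> users N. \<exists>z. optimal N n U z \<and> (i, i') \<in> (link N z)\<^sup>*} = ?C i"
    if "i \<in> users N" for i
    using link y link_users[OF _ that] by blast
  have res: "{j \<in> resources N. \<exists>z i'. optimal N n U z \<and> (i, i') \<in> (link N z)\<^sup>* \<and>
      j \<in> route N i' \<and> 0 < z i' j} = resources_of N y (?C i)" if "i \<in> users N" for i
  proof (intro equalityI subsetI)
    fix j assume "j \<in> {j \<in> resources N. \<exists>z i'. optimal N n U z \<and> (i, i') \<in> (link N z)\<^sup>* \<and>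
      j \<in> route N i' \<and> 0 < z i' j}"
    then obtain z i' where *: "optimal N n U z" "(i, i') \<in> (link N z)\<^sup>*" "j \<in> route N i'" "0 < z i' j"
      by blast
    then have "(i, i') \<in> (link N y)\<^sup>*" using link by blast
    moreover from this have "0 < y i' j" using pos[OF *(1) _ *(3,4)] link_users that by blast
    ultimately show "j \<in> resources_of N y (?C i)" using *(3) by (auto simp: resources_of_def)
  next
    fix j assume "j \<in> resources_of N y (?C i)"
    then obtain i' where i': "(i, i') \<in> (link N y)\<^sup>*" "j \<in> route N i'" "0 < y i' j"
      by (auto simp: resources_of_def)
    then have "j \<in> resources N" using route_sub link_users that by blast
    then show "j \<in> {j \<in> resources N. \<exists>z i'. optimal N n U z \<and> (i, i') \<in> (link N z)\<^sup>* \<and>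
      j \<in> route N i' \<and> 0 < z i' j}" using i' y by blast
  qed
  have C_eq: "?C i' = ?C i" if "i' \<in> ?C i" for i i'
  proof -
    have "(i, i') \<in> (link N y)\<^sup>*" "(i', i) \<in> (link N y)\<^sup>*"
      using that link_sym by (auto dest: symD[OF sym_rtrancl])
    then show ?thesis by (auto intro: rtrancl_trans)
  qed
  have res_sub: "resources_of N y (?C i) \<subseteq> resources N" if "i \<in> users N" for i
    using route_sub link_users that by (auto simp: resources_of_def)
  have unused: "(\<forall>z. optimal N n U z \<longrightarrow> (\<forall>i\<in>users N. j \<in> route N i \<longrightarrow> z i j = 0)) \<longleftrightarrow>
      users_on N y {j} = {}" for j
  proof
    assume "\<forall>z. optimal N n U z \<longrightarrow> (\<forall>i\<in>users N. j \<in> route N i \<longrightarrow> z i j = 0)"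
    then show "users_on N y {j} = {}" using y by (force simp: users_on_def)
  next
    assume *: "users_on N y {j} = {}"
    show "\<forall>z. optimal N n U z \<longrightarrow> (\<forall>i\<in>users N. j \<in> route N i \<longrightarrow> z i j = 0)"
    proof (intro allI impI ballI)
      fix z i assume z: "optimal N n U z" "i \<in> users N" "j \<in> route N i"
      then have "0 \<le> z i j" by (auto simp: optimal_def feasible_def)
      moreover have "\<not> 0 < z i j" using pos[OF z] * z by (auto simp: users_on_def)
      ultimately show "z i j = 0" by simp
    qed
  qed
  have active: "0 < n i'" if "i' \<in> users N" "(i, i') \<in> (link N y)\<^sup>*" "0 < n i" for i i'
    using that(2,3)
    by (cases rule: rtranclE) (use that(1) pos_imp_active in \<open>auto simp: link_def\<close>)
  show ?thesis
  proof (cases "I' = {}")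
    case True
    have "\<not> {} = ?C i" for i by blast
    then show ?thesis
      using True unused
      by (auto simp: cluster_with_rate_def is_cluster_def clusters_at_def component_def)
  next
    case False
    show ?thesis
    proof
      assume c: "cluster_with_rate N n U s I' J'"
      obtain i where i: "i \<in> I'" using False by blast
      have "I' \<subseteq> users N" "J' \<noteq> {}"
        using c unfolding cluster_with_rate_def is_cluster_def by blast+
      then have iu: "i \<in> users N" using i by blast
      have cl: "\<forall>i\<in>I'.
        I' = {i' \<in> users N. \<exists>y. optimal N n U y \<and> (i, i') \<in> (link N y)\<^sup>*} \<and>
        J' = {j \<in> resources N. \<exists>y i'. optimal N n U y \<and> (i, i') \<in> (link N y)\<^sup>* \<and>
          j \<in> route N i' \<and> 0 < y i' j}"
        using c unfolding cluster_with_rate_def is_cluster_def by (elim conjE)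
      have I: "I' = ?C i" and J: "J' = resources_of N y (?C i)"
        using bspec[OF cl i] users[OF iu] res[OF iu] by simp_all
      have s: "ereal (rate N y i) = s"
        using c i y by (auto simp: cluster_with_rate_def)
      \<comment> \<open>Here \<open>J' \<noteq> {}\<close> matters: it yields a linked user who
        draws something and thus has flows. Links lead back from there to \<open>i\<close>, so
        \<open>i\<close> has flows as well.\<close>
      obtain i' j where i': "(i, i') \<in> (link N y)\<^sup>*" "j \<in> route N i'" "0 < y i' j"
        using J \<open>J' \<noteq> {}\<close> by (auto simp: resources_of_def)
      then have "0 < n i'" "i' \<in> users N" using link_users[OF i'(1) iu] pos_imp_active by auto
      moreover have "(i', i) \<in> (link N y)\<^sup>*"
        using i'(1) link_sym by (auto dest: symD[OF sym_rtrancl])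
      ultimately have "0 < n i" using active[OF iu] by blast
      then show "(I', J') \<in> clusters_at N n y s"
        using I J s iu by (auto simp: clusters_at_def component_def active_def)
    next
      assume "(I', J') \<in> clusters_at N n y s"
      then obtain i where i: "i \<in> users N" "0 < n i" "ereal (rate N y i) = s"
        "I' = ?C i" "J' = resources_of N y (?C i)"
        using False by (auto simp: clusters_at_def component_def active_def)
      have sub: "?C i \<subseteq> users N" using link_users i(1) by blast
      obtain j where "j \<in> route N i" "0 < y i j" using active_iff_pos i(1,2) by blast
      then have "J' \<noteq> {}" using i(5) by (auto simp: resources_of_def)
      moreover have "I' = {i'' \<in> users N. \<exists>z. optimal N n U z \<and> (i', i'') \<in> (link N z)\<^sup>*} \<and>
        J' = {j \<in> resources N. \<exists>z i''. optimal N n U z \<and> (i', i'') \<in> (link N z)\<^sup>* \<and>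
          j \<in> route N i'' \<and> 0 < z i'' j}" if "i' \<in> I'" for i'
      proof -
        have "i' \<in> users N" "?C i' = ?C i" using that sub C_eq[of i' i] i(4) by auto
        then show ?thesis using users[of i'] res[of i'] i(4,5) by simp
      qed
      moreover have "ereal (rate N z i') = s" if z: "optimal N n U z" and "i' \<in> I'" for z i'
      proof -
        have l: "(i, i') \<in> (link N y)\<^sup>*" using that(2) i(4) by simp
        have "i' \<in> users N" using that(2) i(4) sub by blast
        then show ?thesis
          using rate[OF z] active[OF _ l i(2)] link_rate[OF l] i(3) by simp
      qed
      ultimately show "cluster_with_rate N n U s I' J'"
        using False sub res_sub[OF i(1)] i(4,5)
        unfolding cluster_with_rate_def is_cluster_def by blast
    qed
  qed
qed

lemma exists_recurrent_fair_optimum: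
  assumes "wf_network N"
    and "\<forall>i\<in>users N. 0 \<le> n i"
    and "utility U"
  obtains y where "optimal N n U y" "recurrent_fair N n y"
    "\<And>z i. optimal N n U z \<Longrightarrow> i \<in> users N \<Longrightarrow> 0 < n i \<Longrightarrow> rate N z i = rate N y i"
    "\<And>s I' J'. cluster_with_rate N n U s I' J' \<longleftrightarrow> (I', J') \<in> clusters_at N n y s"
proof -
  interpret flow_network N n using assms by unfold_locales auto
  obtain y where y: "minimizer y" "\<And>z. minimizer z \<Longrightarrow> support z \<subseteq> support y"
    using exists_maximal_minimizer by blast
  note opt = optimal_iff_minimizer[OF assms(3)]
  have rec: "recurrent_fair N n y" by (rule maximal_recurrent[OF y])
  have rate: "rate N z i = rate N y i" if "optimal N n U z" "i \<in> users N" "0 < n i" for z i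
    using that fair.optimal_iff[OF minimizer_fair[OF y(1)] assms(3)] by blast
  have "0 < y i j" if "optimal N n U z" "i \<in> users N" "j \<in> route N i" "0 < z i j" for z i j
    using y(2)[of z] that opt by (auto simp: support_def)
  then show ?thesis
    using that[OF _ rec rate] cluster_with_rate_iff[OF rec _ _ rate] y(1) opt by blast
qed

theorem theorem3p1:
  fixes N :: "('i, 'j) network" and n :: "'i \<Rightarrow> real" and U :: "real \<Rightarrow> real"
  assumes "wf_network N"
    and "\<forall>i\<in>users N. 0 \<le> n i"
    and "utility U"
  shows "(\<exists>y. optimal N n U y) \<and>
    (\<exists>K.
      users (residual N n K) = {} \<and> resources (residual N n K) = {} \<and>
      (\<forall>k<K. resources (residual N n k) \<noteq> {}) \<and>
      (\<forall>y. optimal N n U y \<longrightarrow>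
         (\<forall>k<K. \<forall>i\<in>step_users (residual N n k) n.
            0 < n i \<longrightarrow> ereal (rate N y i) = min_ratio (residual N n k) n)) \<and>
      (\<forall>k<K. \<forall>J' \<subseteq> resources (residual N n (Suc k)).
         users_within (residual N n (Suc k)) J' =
         users_within (residual N n k) (J' \<union> step_resources (residual N n k) n)
           - users_within (residual N n k) (step_resources (residual N n k) n)) \<and>
      finite (cluster_rates N n U) \<and> card (cluster_rates N n U) = K \<and>
      (\<forall>k<K.
         \<Union> (fst ` cluster_level N n U k) = active n (step_users (residual N n k) n) \<and>
         \<Union> (snd ` cluster_level N n U k) = step_resources (residual N n k) n) \<and>
      (\<forall>k<K. disjoint (minimizers (residual N n k) n) \<longrightarrow>
         cluster_level N n U k =
         (\<lambda>J'. (active n (users_within (residual N n k) J'), J')) ` minimizers (residual N n k) n) \<and>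
      (\<forall>k<K.
         cluster_level N n U k =
         (\<lambda>J'. (active n (own_users (residual N n k) n J'), own_resources (residual N n k) n J')) `
           {J' \<in> minimizers (residual N n k) n. own_resources (residual N n k) n J' \<noteq> {}}))"
proof -
  obtain y where y: "optimal N n U y" "recurrent_fair N n y"
    and opt: "\<And>z i. optimal N n U z \<Longrightarrow> i \<in> users N \<Longrightarrow> 0 < n i \<Longrightarrow> rate N z i = rate N y i"
    and clusters: "\<And>s I' J'. cluster_with_rate N n U s I' J' \<longleftrightarrow> (I', J') \<in> clusters_at N n y s"
    using exists_recurrent_fair_optimum[OF assms] by blast
  have ex: "\<exists>y. optimal N n U y" using y(1) by blast
  interpret recurrent_fair N n y by (rule y(2))
  have rates: "cluster_rates N n U = levels N n y"
    by (auto simp: cluster_rates_def levels_def clusters)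
  \<comment> \<open>One step per distinct level, including the infinite one if some resource carries
    no traffic.\<close>
  define K where "K = card (levels N n y)"
  have level: "cluster_level N n U k =
      clusters_at (residual N n k) n y (min_ratio (residual N n k) n)" if "k < K" for k
    using residual_step(3)[of k] that by (simp add: cluster_level_def clusters rates K_def)
  have own: "cluster_level N n U k =
         (\<lambda>J'. (active n (own_users (residual N n k) n J'), own_resources (residual N n k) n J')) `
           {J' \<in> minimizers (residual N n k) n. own_resources (residual N n k) n J' \<noteq> {}}"
    if "k < K" for k
  proof -
    interpret R: recurrent_fair "residual N n k" n y by (rule residual_fair)
    show ?thesis
      unfolding level[OF that] using R.clusters_at_own residual_step(1) that by (simp add: K_def)
  qed
  show ?thesis
  proof (rule conjI[OF ex], intro exI[of _ K] conjI allI impI ballI)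
    show "users (residual N n K) = {}" "resources (residual N n K) = {}"
      using residual_end by (simp_all add: K_def)
    show "resources (residual N n k) \<noteq> {}" if "k < K" for k
      using residual_step(1) that by (simp add: K_def)
    show "ereal (rate N z i) = min_ratio (residual N n k) n"
      if "optimal N n U z" "k < K" "i \<in> step_users (residual N n k) n" "0 < n i" for z k i
    proof -
      interpret R: recurrent_fair "residual N n k" n y by (rule residual_fair)
      have i: "i \<in> users (residual N n k)"
        using that(3) by (simp add: step_users_def users_within_def)
      have "ereal (rate (residual N n k) y i) = min_ratio (residual N n k) n"
        using R.step_users_iff_rate(1) i that(3,4) by blast
      moreover have "i \<in> users N" using residual_users_sub i by blast
      ultimately show ?thesis using residual_rate[OF i] opt[OF that(1) _ that(4)] by simp
    qed
    show "users_within (residual N n (Suc k)) J' =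
         users_within (residual N n k) (J' \<union> step_resources (residual N n k) n)
           - users_within (residual N n k) (step_resources (residual N n k) n)"
      if "J' \<subseteq> resources (residual N n (Suc k))" for k J'
      using users_within_reduced that by simp
    show "finite (cluster_rates N n U)" "card (cluster_rates N n U) = K"
      using finite_levels by (simp_all add: rates K_def)
    show "\<Union> (fst ` cluster_level N n U k) = active n (step_users (residual N n k) n)"
      "\<Union> (snd ` cluster_level N n U k) = step_resources (residual N n k) n" if "k < K" for k
      unfolding level[OF that]
      by (rule recurrent_fair.Union_clusters_at[OF residual_fair])+
    show "cluster_level N n U k =
         (\<lambda>J'. (active n (own_users (residual N n k) n J'), own_resources (residual N n k) n J')) `
           {J' \<in> minimizers (residual N n k) n. own_resources (residual N n k) n J' \<noteq> {}}"
      if "k < K" for k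
      by (rule own[OF that])
    show "cluster_level N n U k =
         (\<lambda>J'. (active n (users_within (residual N n k) J'), J')) ` minimizers (residual N n k) n"
      if "k < K" and disj: "disjoint (minimizers (residual N n k) n)" for k
      unfolding own[OF that(1)] using disjoint_own[OF disj] by (intro image_cong) auto
  qed
qed

end
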